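(* Let $P=(S_1|\dots|S_k)$ be a partition of a finite set $I$. Then the restricted external product $$\boldsymbol\Gamma^*[{}^IS_1]\otimes\dots\otimes\boldsymbol\Gamma^*[{}^IS_k]\to\boldsymbol\Gamma^*[P],\qquad \mathbf f\mapsto\mathbf{prod}_P(\mathbf f)$$ is a well-defined isomorphism of vector spaces.
   Context: **Arrangement and faces.** $\Bbbk$ is a field of characteristic zero. A partition $P=(S_1|\dots|S_k)$ of $I$ is an unordered set of disjoint nonempty blocks with union $I$; $Q$ is finer than $P$ if every block of $Q$ is contained in a block of $P$ ($Q=P$ allowed). $(I)$ is the one-block partition; for $S\subseteq I$, ${}^IS$ is the partition of $I$ with block $S$ and all other blocks singletons. Put $T^\vee[P]=\{h\in\mathbb R I:\sum_{i\in S_j}h_i=0 \text{ for all } j\}$ and $T^\vee[I]=T^\vee[(I)]$. The adjoint braid arrangement consists of the hyperplanes $\{\sum_{i\in S}h_i=0\}$ of $T^\vee[I]$, for $\emptyset\ne S\subsetneq I$. An adjoint face $X$ is (the characteristic function of) a relatively open face of this arrangement; it is determined by its sign function $s_X$, where $s_X(S)\in\{+,-,0\}$ is the sign of $\sum_{i\in S}h_i$ for $h$ in the face, $\emptyset\neq S\subsetneq I$. Its support is the linear span of the face. $\mathsf L^\vee[P]$ is the $\Bbbk$-vector space with basis the adjoint faces with support $T^\vee[P]$; $\mathsf L^{\vee *}[P]$ is its dual, whose elements are called functionals. **External product, semisimplicity.** For an adjoint face $X\in\mathsf L^\vee[P]$, $X|_{S_j}\in\mathsf L^\vee[{}^IS_j]$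 is the adjoint face with sign $S\mapsto s_X(S\cap S_j)$ if $S\cap S_j\ne\emptyset$, and $0$ if $S\cap S_j=\emptyset$. Define $\mathbf{prod}_P:\bigotimes_j\mathsf L^{\vee*}[{}^IS_j]\to\mathsf L^{\vee*}[P]$ by $\mathbf{prod}_P(f_1\otimes\dots\otimes f_k)(X)=\prod_jf_j(X|_{S_j})$. A functional in $\mathsf L^{\vee*}[P]$ is semisimple if it lies in the image of $\mathbf{prod}_P$. **Forest derivative.** For $E\subseteq I$, $\mathrm{Redn}_P(E)$ is $E$ with all blocks of $P$ contained in $E$ removed; write $E=S \bmod P$ if $\mathrm{Redn}_P(E)=\mathrm{Redn}_P(S)$. A cut $\mathcal V=[C,D]:P\leftarrow Q$ is an ordered splitting of one block $S_m=C\sqcup D$ of $P$ ($C,D\neq\emptyset$), where $Q$ is $P$ with $S_m$ replaced by $C$ and $D$; $\overline{\mathcal V}=[D,C]$. For an adjoint face $X\in\mathsf L^\vee[Q]$, $X^{\mathcal V}\in\mathsf L^\vee[P]$ is the adjoint face with sign at $S$ equal to $+$ if $S=C\bmod P$, $-$ if $S=D\bmod P$, $s_X(S)$ if $S\ne\emptyset\bmod Q$, and $0$ if $S=\emptyset\bmod P$. For $f\in\mathsf L^{\vee*}[P]$ set $\boldsymbol\partial_{\mathcal V}f(X)=f(X^{\mathcal V})-f(X^{\overline{\mathcal V}})$, a functional in $\mathsf L^{\vee *}[Q]$. A layered forest $\mathcal F:P\leftarrow Q$ over $P$ is a family of planar full binary trees, one over each block $S_j$ of $P$ with leaves labelled bijectively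 by the blocks of $Q$ contained in $S_j$, together with a linear order on all the (internal) nodes in which each node precedes its descendants. Equivalently it is a sequence of successive cuts, $\mathcal F=\mathcal V_1\circ\dots\circ\mathcal V_l$, performed in the order of the nodes (starting from $P$ and ending at $Q$; left child $C$, right child $D$). Set $\boldsymbol\partial_{\mathcal F}f=\boldsymbol\partial_{\mathcal V_l}(\cdots(\boldsymbol\partial_{\mathcal V_1}f)\cdots)$; if $l=0$ this is the identity. **Semisimple differentiability.** $f\in\mathsf L^{\vee*}[P]$ is semisimply differentiable if $\boldsymbol\partial_{\mathcal F}f$ is semisimple for all layered forests $\mathcal F$ over $P$. $\boldsymbol\Gamma^*[P]\subseteq\mathsf L^{\vee *}[P]$ is the subspace of semisimply differentiable functionals. *)

theory Defs
  imports
    Complex_Main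
    "HOL-Library.FuncSet"
    "HOL-Library.Disjoint_Sets"
    "HOL-Library.Function_Algebras"
    "HOL-Library.Set_Algebras"
begin

section \<open>Spaces of functions\<close>

text \<open>All vector spaces below are subspaces of a space of functions into the ground field, with the
  pointwise addition of \<^theory>\<open>HOL-Library.Function_Algebras\<close>, or quotients of such subspaces.\<close>

definition fscale :: "'k::field \<Rightarrow> ('b \<Rightarrow> 'k) \<Rightarrow> 'b \<Rightarrow> 'k"
  where "fscale c f = (\<lambda>x. c * f x)"

global_interpretation fun_vs: vector_space fscale
  by standard (auto simp: fscale_def fun_eq_iff algebra_simps)


section \<open>Tensor product of a finite family of subspaces\<close>

text \<open>The tensor product of the subspaces \<open>V j\<close>, \<open>j \<in> J\<close>, is the free vector space on the set
  \<open>PiE J V\<close> of tuples modulo the multilinearity relations. Its elements are cosets; their sum is the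
  elementwise sum \<open>A + B\<close> of \<^theory>\<open>HOL-Library.Set_Algebras\<close>.\<close>

definition free_space :: "'i set \<Rightarrow> ('i \<Rightarrow> 'v set) \<Rightarrow> (('i \<Rightarrow> 'v) \<Rightarrow> 'k::field) set"
  where "free_space J V = {x. finite {t. x t \<noteq> 0} \<and> {t. x t \<noteq> 0} \<subseteq> PiE J V}"

definition free_gen :: "'b \<Rightarrow> 'b \<Rightarrow> 'k::field"
  where "free_gen t = (\<lambda>u. if u = t then 1 else 0)"

definition multilinear_rels ::
    "'i set \<Rightarrow> ('i \<Rightarrow> ('b \<Rightarrow> 'k::field) set) \<Rightarrow> (('i \<Rightarrow> ('b \<Rightarrow> 'k)) \<Rightarrow> 'k) set"
  where "multilinear_rels J V =
     {free_gen (t(j := v + w)) - free_gen (t(j := v)) - free_gen (t(j := w)) |t j v w.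
        t \<in> PiE J V \<and> j \<in> J \<and> v \<in> V j \<and> w \<in> V j}
   \<union> {free_gen (t(j := fscale c v)) - fscale c (free_gen (t(j := v))) |t j c v.
        t \<in> PiE J V \<and> j \<in> J \<and> v \<in> V j}"

definition tensor_null ::
    "'i set \<Rightarrow> ('i \<Rightarrow> ('b \<Rightarrow> 'k::field) set) \<Rightarrow> (('i \<Rightarrow> ('b \<Rightarrow> 'k)) \<Rightarrow> 'k) set"
  where "tensor_null J V = fun_vs.span (multilinear_rels J V)"

definition tensor ::
    "'i set \<Rightarrow> ('i \<Rightarrow> ('b \<Rightarrow> 'k::field) set) \<Rightarrow> (('i \<Rightarrow> ('b \<Rightarrow> 'k)) \<Rightarrow> 'k) set set"
  where "tensor J V = (\<lambda>x. x +o tensor_null J V) ` free_space J V"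

text \<open>The summand \<open>tensor_null J V\<close> only matters for \<open>c = 0\<close>.\<close>

definition tensor_scale ::
    "'i set \<Rightarrow> ('i \<Rightarrow> ('b \<Rightarrow> 'k::field) set) \<Rightarrow> 'k
      \<Rightarrow> (('i \<Rightarrow> ('b \<Rightarrow> 'k)) \<Rightarrow> 'k) set \<Rightarrow> (('i \<Rightarrow> ('b \<Rightarrow> 'k)) \<Rightarrow> 'k) set"
  where "tensor_scale J V c A = fscale c ` A + tensor_null J V"

lemma tensor_add_coset:
  "(x +o tensor_null J V) + (y +o tensor_null J V) = (x + y) +o tensor_null J V"
proof -
  let ?N = "tensor_null J V"
  have "?N + ?N = ?N"
  proof
    show "?N + ?N \<subseteq> ?N"
      by (auto simp: set_plus_def tensor_null_def intro: fun_vs.span_add)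
    have "0 \<in> ?N" by (simp add: tensor_null_def fun_vs.span_zero)
    then show "?N \<subseteq> ?N + ?N" using set_zero_plus2 by blast
  qed
  then show ?thesis by (simp add: set_plus_rearrange)
qed

lemma tensor_scale_coset:
  "tensor_scale J V c (x +o tensor_null J V) = fscale c x +o tensor_null J V"
proof -
  let ?N = "tensor_null J V"
  have "fscale c (x + n) + m \<in> fscale c x +o ?N" if "n \<in> ?N" "m \<in> ?N" for n m
    using that unfolding tensor_null_def elt_set_plus_def
    by (auto simp: fun_vs.scale_right_distrib add.assoc
             intro!: bexI[of _ "fscale c n + m"] fun_vs.span_add fun_vs.span_scale)
  moreover have "fscale c x + m \<in> fscale c ` (x +o ?N) + ?N" if "m \<in> ?N" for m
  proof (rule set_plus_intro[OF imageI that])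
    have "0 \<in> ?N" by (simp add: tensor_null_def fun_vs.span_zero)
    then have "x + 0 \<in> x +o ?N" by (rule set_plus_intro2)
    then show "x \<in> x +o ?N" by simp
  qed
  ultimately show ?thesis
    by (auto simp: tensor_scale_def elt_set_plus_def set_plus_def)
qed


section \<open>Faces of the adjoint braid arrangement\<close>

text \<open>\<open>\<real>I\<close> consists of the functions \<open>h\<close> vanishing outside \<open>I\<close>. Partitions are sets of blocks
  satisfying \<^const>\<open>partition_on\<close>.\<close>

definition Tv :: "'a set \<Rightarrow> 'a set set \<Rightarrow> ('a \<Rightarrow> real) set"
  where "Tv I P = {h. (\<forall>i. i \<notin> I \<longrightarrow> h i = 0) \<and> (\<forall>S\<in>P. sum h S = 0)}"

definition single_block :: "'a set \<Rightarrow> 'a set \<Rightarrow> 'a set set"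
  where "single_block I S = insert S ((\<lambda>i. {i}) ` (I - S))"

text \<open>Signs are the real numbers \<open>1, -1, 0\<close>. If no point has sign function \<open>s\<close>, then
  \<open>face_of_sign I s\<close> is empty, hence not a face.\<close>

definition face_of_sign :: "'a set \<Rightarrow> ('a set \<Rightarrow> real) \<Rightarrow> ('a \<Rightarrow> real) set"
  where "face_of_sign I s =
    {h \<in> Tv I {I}. \<forall>S. S \<noteq> {} \<and> S \<subset> I \<longrightarrow> sgn (sum h S) = s S}"

definition adjoint_faces :: "'a set \<Rightarrow> ('a \<Rightarrow> real) set set"
  where "adjoint_faces I = range (face_of_sign I) - {{}}"

definition face_sign :: "('a \<Rightarrow> real) set \<Rightarrow> 'a set \<Rightarrow> real"
  where "face_sign X S = the_elem ((\<lambda>h. sgn (sum h S)) ` X)"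

definition faces :: "'a set \<Rightarrow> 'a set set \<Rightarrow> ('a \<Rightarrow> real) set set"
  where "faces I P = {X \<in> adjoint_faces I. fun_vs.span X = Tv I P}"

text \<open>A functional is given by its values on the basis \<open>faces I P\<close>, extended by \<open>0\<close> to all sets.\<close>

definition functionals :: "'a set \<Rightarrow> 'a set set \<Rightarrow> (('a \<Rightarrow> real) set \<Rightarrow> 'k::field) set"
  where "functionals I P = {f. \<forall>X. X \<notin> faces I P \<longrightarrow> f X = 0}"


section \<open>External product\<close>

definition face_restrict :: "'a set \<Rightarrow> 'a set \<Rightarrow> ('a \<Rightarrow> real) set \<Rightarrow> ('a \<Rightarrow> real) set"
  where "face_restrict I B X =
    face_of_sign I (\<lambda>S. if S \<inter> B \<noteq> {} then face_sign X (S \<inter> B) else 0)"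

definition prod_pure :: "'a set \<Rightarrow> 'a set set \<Rightarrow> ('a set \<Rightarrow> ('a \<Rightarrow> real) set \<Rightarrow> 'k::field)
    \<Rightarrow> ('a \<Rightarrow> real) set \<Rightarrow> 'k"
  where "prod_pure I P f =
    (\<lambda>X. if X \<in> faces I P then \<Prod>B\<in>P. f B (face_restrict I B X) else 0)"

definition prod_free :: "'a set \<Rightarrow> 'a set set
    \<Rightarrow> (('a set \<Rightarrow> ('a \<Rightarrow> real) set \<Rightarrow> 'k::field) \<Rightarrow> 'k) \<Rightarrow> ('a \<Rightarrow> real) set \<Rightarrow> 'k"
  where "prod_free I P x = (\<Sum>t | x t \<noteq> 0. fscale (x t) (prod_pure I P t))"

text \<open>The map induced on cosets. It does not mention the factors \<open>V\<close> of the tensor product, so on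
  \<open>tensor P V\<close> for smaller subspaces \<open>V\<close> it is the restriction, i.e. the composite with
  the map of tensor products induced by the inclusions.\<close>

definition ext_prod :: "'a set \<Rightarrow> 'a set set
    \<Rightarrow> (('a set \<Rightarrow> ('a \<Rightarrow> real) set \<Rightarrow> 'k::field) \<Rightarrow> 'k) set \<Rightarrow> ('a \<Rightarrow> real) set \<Rightarrow> 'k"
  where "ext_prod I P A = the_elem (prod_free I P ` A)"

definition semisimple :: "'a set \<Rightarrow> 'a set set \<Rightarrow> (('a \<Rightarrow> real) set \<Rightarrow> 'k::field) \<Rightarrow> bool"
  where "semisimple I P f \<longleftrightarrow>
    f \<in> ext_prod I P ` tensor P (\<lambda>B. functionals I (single_block I B))"


lemma prod_free_sum:
  assumes "finite S" "{t. x t \<noteq> 0} \<subseteq> S"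
  shows "prod_free I P x = (\<Sum>t\<in>S. fscale (x t) (prod_pure I P t))"
  unfolding prod_free_def
  by (rule sum.mono_neutral_left) (use assms in \<open>auto simp: fscale_def fun_eq_iff\<close>)

lemma prod_free_add:
  assumes x: "finite {t. x t \<noteq> 0}" and y: "finite {t. y t \<noteq> 0}"
  shows "prod_free I P (x + y) = prod_free I P x + prod_free I P y"
proof -
  let ?S = "{t. x t \<noteq> 0} \<union> {t. y t \<noteq> 0}"
  have S: "finite ?S" using x y by simp
  have "prod_free I P (x + y) = (\<Sum>t\<in>?S. fscale ((x + y) t) (prod_pure I P t))"
    by (rule prod_free_sum[OF S]) auto
  also have "\<dots> = (\<Sum>t\<in>?S. fscale (x t) (prod_pure I P t)) + (\<Sum>t\<in>?S. fscale (y t) (prod_pure I P t))"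
    by (simp add: fun_vs.scale_left_distrib sum.distrib)
  also have "(\<Sum>t\<in>?S. fscale (x t) (prod_pure I P t)) = prod_free I P x"
    by (rule prod_free_sum[OF S, symmetric]) auto
  also have "(\<Sum>t\<in>?S. fscale (y t) (prod_pure I P t)) = prod_free I P y"
    by (rule prod_free_sum[OF S, symmetric]) auto
  finally show ?thesis .
qed

lemma prod_free_scale:
  fixes x :: "('a set \<Rightarrow> ('a \<Rightarrow> real) set \<Rightarrow> 'b::field) \<Rightarrow> 'b"
  assumes x: "finite {t. x t \<noteq> 0}"
  shows "prod_free I P (fscale c x) = fscale c (prod_free I P x)"
proof -
  have "prod_free I P (fscale c x) = (\<Sum>t | x t \<noteq> 0. fscale (fscale c x t) (prod_pure I P t))"
    by (rule prod_free_sum[OF x]) (auto simp: fscale_def)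
  moreover have "fscale (fscale c x t) p = fscale c (fscale (x t) p)" for t and p :: "('a \<Rightarrow> real) set \<Rightarrow> 'b"
    by (simp add: fscale_def mult.assoc)
  ultimately show ?thesis
    by (simp only: prod_free_def fun_vs.scale_sum_right)
qed

lemma finite_support_free_gen: "finite {u. free_gen t u \<noteq> (0::'k::field)}"
  by (rule finite_subset[of _ "{t}"]) (auto simp: free_gen_def)

lemma finite_support_subspace: "fun_vs.subspace {x :: 'b \<Rightarrow> 'k::field. finite {t. x t \<noteq> 0}}"
proof (rule fun_vs.subspaceI; clarsimp)
  fix x y :: "'b \<Rightarrow> 'k" assume "finite {t. x t \<noteq> 0}" "finite {t. y t \<noteq> 0}"
  then have "finite ({t. x t \<noteq> 0} \<union> {t. y t \<noteq> 0})" by simp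
  then show "finite {t. x t + y t \<noteq> 0}" by (rule rev_finite_subset) auto
next
  fix c and x :: "'b \<Rightarrow> 'k" assume "finite {t. x t \<noteq> 0}"
  then show "finite {t. fscale c x t \<noteq> 0}"
    by (rule rev_finite_subset) (auto simp: fscale_def)
qed

lemma prod_free_gen: "prod_free I P (free_gen t) = prod_pure I P t"
  by (subst prod_free_sum[of "{t}"]) (auto simp: free_gen_def)

lemma prod_pure_add:
  assumes "finite P" "j \<in> P"
  shows "prod_pure I P (t(j := v + w)) = prod_pure I P (t(j := v)) + prod_pure I P (t(j := w))"
proof
  fix X
  have *: "(\<Prod>B\<in>P. (t(j := u)) B (face_restrict I B X)) =
      u (face_restrict I j X) * (\<Prod>B\<in>P - {j}. t B (face_restrict I B X))" for u
    using assms by (subst prod.remove[of P j]) (auto intro!: prod.cong)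
  show "prod_pure I P (t(j := v + w)) X = (prod_pure I P (t(j := v)) + prod_pure I P (t(j := w))) X"
    unfolding prod_pure_def plus_fun_apply * by (simp add: algebra_simps)
qed

lemma prod_pure_scale:
  assumes "finite P" "j \<in> P"
  shows "prod_pure I P (t(j := fscale c v)) = fscale c (prod_pure I P (t(j := v)))"
proof
  fix X
  have *: "(\<Prod>B\<in>P. (t(j := u)) B (face_restrict I B X)) =
      u (face_restrict I j X) * (\<Prod>B\<in>P - {j}. t B (face_restrict I B X))" for u
    using assms by (subst prod.remove[of P j]) (auto intro!: prod.cong)
  show "prod_pure I P (t(j := fscale c v)) X = fscale c (prod_pure I P (t(j := v))) X"
    unfolding prod_pure_def fscale_def[of _ "\<lambda>X. _ X"] * by (simp add: fscale_def)
qed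

lemma tensor_null_finite:
  "tensor_null J V \<subseteq> {x. finite {t. x t \<noteq> 0}}"
proof -
  note [intro] = fun_vs.subspace_diff[OF finite_support_subspace, unfolded mem_Collect_eq]
    fun_vs.subspace_scale[OF finite_support_subspace, unfolded mem_Collect_eq]
    finite_support_free_gen
  have "multilinear_rels J V \<subseteq> {x. finite {t. x t \<noteq> 0}}"
    unfolding multilinear_rels_def by blast
  then show ?thesis
    unfolding tensor_null_def by (rule fun_vs.span_minimal[OF _ finite_support_subspace])
qed

lemma prod_free_diff:
  assumes x: "finite {t. x t \<noteq> 0}" and y: "finite {t. y t \<noteq> 0}"
  shows "prod_free I P (x - y) = prod_free I P x - prod_free I P y"
proof -
  have d: "finite {t. (x - y) t \<noteq> 0}"
    using fun_vs.subspace_diff[OF finite_support_subspace, of x y] x y by simp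
  have "prod_free I P ((x - y) + y) = prod_free I P (x - y) + prod_free I P y"
    by (rule prod_free_add[OF d y])
  then show ?thesis by (simp add: algebra_simps)
qed

lemma prod_free_null:
  fixes x :: "('a set \<Rightarrow> ('a \<Rightarrow> real) set \<Rightarrow> 'b::field) \<Rightarrow> 'b"
  assumes "finite P" "x \<in> tensor_null P V"
  shows "prod_free I P x = 0"
proof -
  let ?K = "{x :: ('a set \<Rightarrow> ('a \<Rightarrow> real) set \<Rightarrow> 'b) \<Rightarrow> 'b. finite {t. x t \<noteq> 0} \<and> prod_free I P x = 0}"
  have "fun_vs.subspace ?K"
  proof (rule fun_vs.subspaceI)
    show "0 \<in> ?K" by (simp add: prod_free_def)
  next
    fix x y :: "('a set \<Rightarrow> ('a \<Rightarrow> real) set \<Rightarrow> 'b) \<Rightarrow> 'b" assume "x \<in> ?K" "y \<in> ?K"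
    then show "x + y \<in> ?K"
      using fun_vs.subspace_add[OF finite_support_subspace, of x y] by (simp add: prod_free_add)
  next
    fix c x assume "x \<in> ?K"
    then show "fscale c x \<in> ?K"
      using fun_vs.subspace_scale[OF finite_support_subspace, of x c] by (simp add: prod_free_scale)
  qed
  moreover have "multilinear_rels P V \<subseteq> ?K"
  proof
    fix r assume r: "r \<in> multilinear_rels P V"
    then have f: "finite {t. r t \<noteq> 0}"
      using tensor_null_finite[of P V] fun_vs.span_base[OF r] unfolding tensor_null_def by blast
    have fin: "finite {t. (free_gen u - free_gen v) t \<noteq> (0::'b)}" for u v :: "'a set \<Rightarrow> ('a \<Rightarrow> real) set \<Rightarrow> 'b"
      using fun_vs.subspace_diff[OF finite_support_subspace, of "free_gen u" "free_gen v"]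
      by (simp add: finite_support_free_gen)
    have fin2: "finite {t. fscale c (free_gen v) t \<noteq> (0::'b)}" for c and v :: "'a set \<Rightarrow> ('a \<Rightarrow> real) set \<Rightarrow> 'b"
      using fun_vs.subspace_scale[OF finite_support_subspace, of "free_gen v" c]
      by (simp add: finite_support_free_gen)
    from r have "prod_free I P r = 0"
      unfolding multilinear_rels_def
      by (elim UnE CollectE exE conjE)
        (simp_all only: prod_free_diff prod_free_scale fin fin2 finite_support_free_gen prod_free_gen
          prod_pure_add prod_pure_scale \<open>finite P\<close>, simp_all)
    with f show "r \<in> ?K" by simp
  qed
  ultimately have "tensor_null P V \<subseteq> ?K"
    unfolding tensor_null_def by (intro fun_vs.span_minimal)
  with assms(2) show ?thesis by blast
qed

lemma ext_prod_coset:
  assumes "finite P" "x \<in> free_space P V"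
  shows "ext_prod I P (x +o tensor_null P V) = prod_free I P x"
proof -
  have "prod_free I P (x + n) = prod_free I P x" if "n \<in> tensor_null P V" for n
    using that assms tensor_null_finite[of P V]
    by (subst prod_free_add) (auto simp: free_space_def prod_free_null)
  moreover have "0 \<in> tensor_null P V" by (simp add: tensor_null_def fun_vs.span_zero)
  ultimately have "prod_free I P ` (x +o tensor_null P V) = {prod_free I P x}"
    unfolding elt_set_plus_def by force
  then show ?thesis by (simp add: ext_prod_def)
qed

lemma free_space_subspace:
  fixes V :: "'a \<Rightarrow> 'b set"
  shows "fun_vs.subspace (free_space J V :: (('a \<Rightarrow> 'b) \<Rightarrow> 'c::field) set)"
proof (rule fun_vs.subspaceI)
  show "0 \<in> free_space J V" by (simp add: free_space_def)
next
  fix x y :: "('a \<Rightarrow> 'b) \<Rightarrow> 'c" assume "x \<in> free_space J V" "y \<in> free_space J V"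
  then show "x + y \<in> free_space J V"
    using fun_vs.subspace_add[OF finite_support_subspace, of x y]
    unfolding free_space_def plus_fun_apply mem_Collect_eq subset_iff
    by (metis (mono_tags, lifting) add.right_neutral)
next
  fix c and x :: "('a \<Rightarrow> 'b) \<Rightarrow> 'c" assume "x \<in> free_space J V"
  then show "fscale c x \<in> free_space J V"
    using fun_vs.subspace_scale[OF finite_support_subspace, of x c]
    by (auto simp: free_space_def fscale_def)
qed

lemma ext_prod_pure:
  fixes V :: "'a set \<Rightarrow> (('a \<Rightarrow> real) set \<Rightarrow> 'b::field) set"
  assumes "finite P" "t \<in> PiE P V"
  shows "ext_prod I P (free_gen t +o tensor_null P V) = prod_pure I P t"
proof -
  have "{u. free_gen t u \<noteq> (0::'b)} \<subseteq> {t}" by (auto simp: free_gen_def)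
  then have "(free_gen t :: _ \<Rightarrow> 'b) \<in> free_space P V"
    using assms(2) finite_support_free_gen[of t] by (auto simp: free_space_def)
  then show ?thesis by (simp add: ext_prod_coset[OF assms(1)] prod_free_gen)
qed

lemma semisimple_subspace:
  assumes "finite P"
  shows "fun_vs.subspace {f :: ('a \<Rightarrow> real) set \<Rightarrow> 'b::field. semisimple I P f}"
proof -
  let ?V = "\<lambda>B. functionals I (single_block I B) :: (('a \<Rightarrow> real) set \<Rightarrow> 'b) set"
  have "{f. semisimple I P f} = prod_free I P ` free_space P ?V"
    unfolding semisimple_def tensor_def image_image Collect_mem_eq
    by (intro image_cong refl ext_prod_coset assms)
  moreover have "fun_vs.subspace (prod_free I P ` free_space P ?V)"
  proof (rule fun_vs.subspaceI)
    show "0 \<in> prod_free I P ` free_space P ?V"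
      using fun_vs.subspace_0[OF free_space_subspace[of P ?V]]
      by (force simp: prod_free_def)
  next
    fix f g :: "('a \<Rightarrow> real) set \<Rightarrow> 'b" assume "f \<in> prod_free I P ` free_space P ?V" "g \<in> prod_free I P ` free_space P ?V"
    then obtain x y where xy: "x \<in> free_space P ?V" "y \<in> free_space P ?V"
      "f = prod_free I P x" "g = prod_free I P y" by blast
    then have "f + g = prod_free I P (x + y)"
      by (simp add: prod_free_add free_space_def)
    with xy show "f + g \<in> prod_free I P ` free_space P ?V"
      using fun_vs.subspace_add[OF free_space_subspace] by blast
  next
    fix c and f :: "('a \<Rightarrow> real) set \<Rightarrow> 'b" assume "f \<in> prod_free I P ` free_space P ?V"
    then obtain x where x: "x \<in> free_space P ?V" "f = prod_free I P x" by blast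
    then have "fscale c f = prod_free I P (fscale c x)"
      by (simp add: prod_free_scale free_space_def)
    with x show "fscale c f \<in> prod_free I P ` free_space P ?V"
      using fun_vs.subspace_scale[OF free_space_subspace] by blast
  qed
  ultimately show ?thesis by simp
qed


section \<open>Forest derivative\<close>

definition redn :: "'a set set \<Rightarrow> 'a set \<Rightarrow> 'a set"
  where "redn P E = E - \<Union>{B \<in> P. B \<subseteq> E}"

definition is_cut :: "'a set set \<Rightarrow> 'a set \<times> 'a set \<Rightarrow> bool"
  where "is_cut P = (\<lambda>(C, D). C \<noteq> {} \<and> D \<noteq> {} \<and> C \<inter> D = {} \<and> C \<union> D \<in> P)"

definition cut_target :: "'a set set \<Rightarrow> 'a set \<times> 'a set \<Rightarrow> 'a set set"
  where "cut_target P = (\<lambda>(C, D). P - {C \<union> D} \<union> {C, D})"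

definition face_cut :: "'a set \<Rightarrow> 'a set set \<Rightarrow> 'a set \<times> 'a set
    \<Rightarrow> ('a \<Rightarrow> real) set \<Rightarrow> ('a \<Rightarrow> real) set"
  where "face_cut I P = (\<lambda>(C, D) X. face_of_sign I (\<lambda>S.
      if redn P S = redn P C then 1
      else if redn P S = redn P D then -1
      else if redn (cut_target P (C, D)) S \<noteq> {} then face_sign X S
      else 0))"

definition cut_deriv :: "'a set \<Rightarrow> 'a set set \<Rightarrow> 'a set \<times> 'a set
    \<Rightarrow> (('a \<Rightarrow> real) set \<Rightarrow> 'k::field) \<Rightarrow> ('a \<Rightarrow> real) set \<Rightarrow> 'k"
  where "cut_deriv I P = (\<lambda>(C, D) f X. if X \<in> faces I (cut_target P (C, D))
      then f (face_cut I P (C, D) X) - f (face_cut I P (D, C) X) else 0)"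

text \<open>A layered forest over \<open>P\<close> is the list of the cuts at its nodes, in the order of the nodes:
  the head of the list is the first cut, of a block of \<open>P\<close>.\<close>

fun layered_forest :: "'a set set \<Rightarrow> ('a set \<times> 'a set) list \<Rightarrow> bool" where
  "layered_forest P [] \<longleftrightarrow> True"
| "layered_forest P (v # F) \<longleftrightarrow> is_cut P v \<and> layered_forest (cut_target P v) F"

fun forest_target :: "'a set set \<Rightarrow> ('a set \<times> 'a set) list \<Rightarrow> 'a set set" where
  "forest_target P [] = P"
| "forest_target P (v # F) = forest_target (cut_target P v) F"

fun forest_deriv :: "'a set \<Rightarrow> 'a set set \<Rightarrow> ('a set \<times> 'a set) list
    \<Rightarrow> (('a \<Rightarrow> real) set \<Rightarrow> 'k::field) \<Rightarrow> ('a \<Rightarrow> real) set \<Rightarrow> 'k" where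
  "forest_deriv I P [] f = f"
| "forest_deriv I P (v # F) f = forest_deriv I (cut_target P v) F (cut_deriv I P v f)"

definition Gam :: "'a set \<Rightarrow> 'a set set \<Rightarrow> (('a \<Rightarrow> real) set \<Rightarrow> 'k::field) set"
  where "Gam I P = {f \<in> functionals I P.
    \<forall>F. layered_forest P F \<longrightarrow> semisimple I (forest_target P F) (forest_deriv I P F f)}"

lemma functionals_subspace: "fun_vs.subspace (functionals I P)"
  by (rule fun_vs.subspaceI) (auto simp: functionals_def fscale_def)

lemma forest_deriv_0: "forest_deriv I P F (0 :: ('a \<Rightarrow> real) set \<Rightarrow> 'k::field) = 0"
proof (induction F arbitrary: P)
  case (Cons v F)
  have "cut_deriv I P v (0 :: ('a \<Rightarrow> real) set \<Rightarrow> 'k) = 0"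
    by (auto simp: cut_deriv_def fun_eq_iff split: prod.split)
  with Cons.IH show ?case by (simp only: forest_deriv.simps)
qed simp

lemma forest_deriv_add:
  "forest_deriv I P F (f + g) = forest_deriv I P F f + forest_deriv I P F g"
proof (induction F arbitrary: P f g)
  case (Cons v F)
  have "cut_deriv I P v (f + g) = cut_deriv I P v f + cut_deriv I P v g"
    by (auto simp: cut_deriv_def fun_eq_iff split: prod.split)
  with Cons.IH show ?case by (simp only: forest_deriv.simps)
qed simp

lemma forest_deriv_scale: "forest_deriv I P F (fscale c f) = fscale c (forest_deriv I P F f)"
proof (induction F arbitrary: P f)
  case (Cons v F)
  have "cut_deriv I P v (fscale c f) = fscale c (cut_deriv I P v f)"
    by (auto simp: cut_deriv_def fscale_def fun_eq_iff algebra_simps split: prod.split)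
  with Cons.IH show ?case by (simp only: forest_deriv.simps)
qed simp

lemma finite_forest_target: "finite P \<Longrightarrow> finite (forest_target P F)"
  by (induction F arbitrary: P) (auto simp: cut_target_def split: prod.split)

lemma Gam_subspace:
  assumes "finite P"
  shows "fun_vs.subspace (Gam I P)"
proof -
  note ss = semisimple_subspace[OF finite_forest_target[OF assms]]
  note fs = functionals_subspace[of I P]
  show ?thesis
    unfolding Gam_def
    by (rule fun_vs.subspaceI; unfold mem_Collect_eq forest_deriv_0 forest_deriv_add forest_deriv_scale;
        intro conjI allI impI)
      (use fun_vs.subspace_0[OF ss] fun_vs.subspace_add[OF ss] fun_vs.subspace_scale[OF ss]
        fun_vs.subspace_0[OF fs] fun_vs.subspace_add[OF fs] fun_vs.subspace_scale[OF fs]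
       in blast)+
qed

end

(* A face of the adjoint braid arrangement is handled through a point h of it, on which only the
   signs of the sums over S matter. Restricting a face to B means setting h to 0 off B; the two
   faces X^V and X^{V-bar} of a cut V = [C, D] are those of h + e w and h - e w, where
   w = 1_c - 1_d with c in C, d in D and e > 0 is small; faces prescribed on complementary sets are
   glued by h + e g. Since every tuple of faces of the blocks of P arises from a face with support
   T[P], a functional is semisimple iff it depends only on the restrictions to the blocks, and the
   external product is injective.

   A cut of a block inside S_j affects only the j-th factor of an external product, so products of
   semisimply differentiable functionals are semisimply differentiable. Conversely, freezing the
   restriction of the argument to the complement of S_j turns a semisimply differentiable
   functional on P into one on S_j. Such a functional is therefore, in every variable separately,
   in the j-th space, and expanding it in each variable shows that it is in the tensor product. *)

theory Submission
  imports Defs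
begin

section \<open>Dual families and expansion of multilinear maps\<close>

text \<open>Why membership in every variable separately suffices: on a subspace of functions on a
  finite set, evaluations at suitable points \<open>A\<close> are coordinates,
  \<open>v = (\<Sum>a\<in>A. fscale (v a) (w a))\<close> with all \<open>w a\<close> in the
  subspace. With such coordinates for every block, injectivity and surjectivity come from one and
  the same expansion. Applied to a formal combination of tuples, it leaves, modulo the
  multilinearity relations, coefficients that are values of the external product at glued faces, so
  a vanishing product forces a null tensor. Applied to a functional in each of its variables, it
  yields a combination of pure products of the vectors \<open>w a\<close>. The obstacle on the
  geometric side: cuts refine the partition, so a block of \<open>P\<close> soon is only a union of
  blocks of the current partition \<open>Q\<close>. Restriction, gluing and genericity are therefore
  developed for unions of blocks, and the inductions over forests keep \<open>P\<close>, or the set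
  \<open>B\<close>, fixed while \<open>Q\<close> varies.\<close>

lemma sum_fun_apply: "(\<Sum>a\<in>A. f a) x = (\<Sum>a\<in>A. f a x)"
  for f :: "'a \<Rightarrow> 'b \<Rightarrow> 'k::field"
  by (induction A rule: infinite_finite_induct) auto

text \<open>Gaussian elimination, one point of \<open>\<Omega>\<close> at a time; \<open>A\<close>
  collects the pivots. That the coefficients are the values of \<open>v\<close> itself is what later
  turns coefficients of tensors into values at faces.\<close>

lemma dual_family_exists:
  fixes W :: "('b \<Rightarrow> 'k::field) set"
  assumes "finite \<Omega>" "fun_vs.subspace W" "\<And>v x. v \<in> W \<Longrightarrow> x \<notin> \<Omega> \<Longrightarrow> v x = 0"
  shows "\<exists>A w. A \<subseteq> \<Omega> \<and> (\<forall>a\<in>A. w a \<in> W) \<and> (\<forall>v\<in>W. v = (\<Sum>a\<in>A. fscale (v a) (w a)))"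
  using assms
proof (induction \<Omega> arbitrary: W rule: finite_induct)
  case empty
  then show ?case by (intro exI[of _ "{}"]) (auto simp: fun_eq_iff)
next
  case (insert x \<Omega>)
  let ?W0 = "{v \<in> W. v x = 0}"
  note sub = insert.prems(1)
  have "fun_vs.subspace ?W0"
    using fun_vs.subspace_0[OF sub] fun_vs.subspace_add[OF sub] fun_vs.subspace_scale[OF sub]
    by (intro fun_vs.subspaceI) (simp_all, simp add: fscale_def)
  moreover have "v y = 0" if "v \<in> ?W0" "y \<notin> \<Omega>" for v y
    using that insert.prems(2)[of v y] by auto
  ultimately have "\<exists>A w. A \<subseteq> \<Omega> \<and> (\<forall>a\<in>A. w a \<in> ?W0) \<and>
      (\<forall>v\<in>?W0. v = (\<Sum>a\<in>A. fscale (v a) (w a)))"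
    by (rule insert.IH)
  then obtain A w where A: "A \<subseteq> \<Omega>" "\<forall>a\<in>A. w a \<in> ?W0"
    and dual: "\<forall>v\<in>?W0. v = (\<Sum>a\<in>A. fscale (v a) (w a))"
    by (elim exE conjE)
  show ?case
  proof (cases "\<forall>v\<in>W. v x = 0")
    case True
    then have "?W0 = W" by auto
    with A dual show ?thesis by (intro exI[of _ A] exI[of _ w] conjI) (blast, simp_all only:)
  next
    case False
    then obtain u0 where u0: "u0 \<in> W" "u0 x \<noteq> 0" by blast
    define u where "u = fscale (1 / u0 x) u0"
    have u: "u \<in> W" "u x = 1"
      unfolding u_def by (rule fun_vs.subspace_scale[OF sub u0(1)]) (use u0(2) in \<open>simp add: fscale_def\<close>)
    \<comment> \<open>Removing \<open>v x\<close> times \<open>u\<close> from \<open>v\<close>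
      changes the value at \<open>a\<close> by \<open>v x * u a\<close>. Subtracting the
      \<open>A\<close>-part from \<open>u\<close> compensates for this, so that the coefficient of
      \<open>w a\<close> stays \<open>v a\<close>.\<close>
    define u' where "u' = u - (\<Sum>a\<in>A. fscale (u a) (w a))"
    have xA: "x \<notin> A" and finA: "finite A"
      using A(1) insert.hyps finite_subset by auto
    have wW: "w a \<in> W" if "a \<in> A" for a using A(2) that by auto
    have u': "u' \<in> W"
      unfolding u'_def
      by (intro fun_vs.subspace_diff[OF sub u(1)] fun_vs.subspace_sum[OF sub]
          fun_vs.subspace_scale[OF sub] wW)
    have "v = (\<Sum>a\<in>insert x A. fscale (v a) ((w(x := u')) a))" if v: "v \<in> W" for v
    proof -
      let ?v = "v - fscale (v x) u"
      have "?v \<in> ?W0"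
        using v u fun_vs.subspace_diff[OF sub] fun_vs.subspace_scale[OF sub]
        by (auto simp: fscale_def)
      with dual have "?v = (\<Sum>a\<in>A. fscale (?v a) (w a))" by blast
      also have "\<dots> = (\<Sum>a\<in>A. fscale (v a) (w a)) - fscale (v x) (\<Sum>a\<in>A. fscale (u a) (w a))"
        unfolding fun_vs.scale_sum_right sum_subtractf[symmetric]
        by (intro sum.cong refl) (simp add: fscale_def fun_eq_iff algebra_simps)
      finally have "v = (\<Sum>a\<in>A. fscale (v a) (w a)) + fscale (v x) u'"
        by (simp add: u'_def algebra_simps)
      moreover have "(\<Sum>a\<in>A. fscale (v a) ((w(x := u')) a)) = (\<Sum>a\<in>A. fscale (v a) (w a))"
        using xA by (intro sum.cong) auto
      ultimately show ?thesis
        using xA finA by (simp add: add.commute)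
    qed
    then show ?thesis
      using A(1) wW u' by (intro exI[of _ "insert x A"] exI[of _ "w(x := u')"]) auto
  qed
qed

text \<open>Iterates the one-coordinate expansions \<open>expand\<close> over \<open>J\<close>. It
  serves twice, with opposite roles: for injectivity the variables are vectors and the coefficients
  their values at points; for surjectivity the variables are faces and the coefficients are the
  values of dual vectors at them.\<close>

lemma multilinear_expansion:
  fixes \<Phi> :: "('i \<Rightarrow> 'y) \<Rightarrow> 'b \<Rightarrow> 'k::field"
  assumes J: "finite J" and N: "fun_vs.subspace N"
    and finA: "\<And>j. j \<in> J \<Longrightarrow> finite (A j)"
    and e: "\<And>j a. j \<in> J \<Longrightarrow> a \<in> A j \<Longrightarrow> e j a \<in> Y j"
    and expand: "\<And>y j. y \<in> PiE J Y \<Longrightarrow> j \<in> J \<Longrightarrow>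
        \<Phi> y - (\<Sum>a\<in>A j. fscale (c j a (y j)) (\<Phi> (y(j := e j a)))) \<in> N"
    and y: "y \<in> PiE J Y"
  shows "\<Phi> y - (\<Sum>a\<in>PiE J A. fscale (\<Prod>j\<in>J. c j (a j) (y j)) (\<Phi> (\<lambda>j\<in>J. e j (a j)))) \<in> N"
proof -
  \<comment> \<open>In \<open>r K a\<close> the coordinates in \<open>K\<close> are already replaced
    by \<open>e j (a j)\<close>, the others are still those of \<open>y\<close>; the induction runs
    over \<open>K\<close>.\<close>
  define r where "r K a = (\<lambda>j. if j \<in> K then e j (a j) else y j)" for K a
  have "\<Phi> y - (\<Sum>a\<in>PiE K A. fscale (\<Prod>j\<in>K. c j (a j) (y j)) (\<Phi> (r K a))) \<in> N" if "K \<subseteq> J" for K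
    using finite_subset[OF that J] that
  proof (induction K rule: finite_induct)
    case empty
    have "r {} a = y" for a by (simp add: r_def)
    then show ?case using fun_vs.subspace_0[OF N] by (simp add: zero_fun_def)
  next
    case (insert i K)
    then have i: "i \<in> J" "i \<notin> K" "K \<subseteq> J" by auto
    have rP: "r K a \<in> PiE J Y" if "a \<in> PiE K A" for a
    proof (rule PiE_I)
      fix j assume j: "j \<in> J"
      show "r K a j \<in> Y j"
        using e[OF j PiE_mem[OF that]] PiE_mem[OF y j] by (auto simp: r_def)
    next
      fix j assume "j \<notin> J"
      then show "r K a j = undefined"
        using i(3) PiE_arb[OF y] by (auto simp: r_def)
    qed
    have upd: "r (insert i K) (a(i := b)) = (r K a)(i := e i b)" if "a \<in> PiE K A" for a b
      using i(2) by (simp add: r_def fun_eq_iff)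
    have "(\<Sum>a\<in>PiE (insert i K) A. fscale (\<Prod>j\<in>insert i K. c j (a j) (y j)) (\<Phi> (r (insert i K) a)))
        = (\<Sum>(b, a)\<in>A i \<times> PiE K A. fscale (\<Prod>j\<in>insert i K. c j ((a(i := b)) j) (y j))
             (\<Phi> (r (insert i K) (a(i := b)))))"
      unfolding PiE_insert_eq
      by (subst sum.reindex) (auto intro!: sum.cong inj_combinator i(2))
    also have "\<dots> = (\<Sum>(b, a)\<in>A i \<times> PiE K A. fscale (\<Prod>j\<in>K. c j (a j) (y j))
             (fscale (c i b (y i)) (\<Phi> ((r K a)(i := e i b)))))"
    proof (intro sum.cong refl, clarify)
      fix b a assume a: "a \<in> PiE K A"
      have "(\<Prod>j\<in>K. c j ((a(i := b)) j) (y j)) = (\<Prod>j\<in>K. c j (a j) (y j))"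
        using i(2) by (intro prod.cong) auto
      then show "fscale (\<Prod>j\<in>insert i K. c j ((a(i := b)) j) (y j)) (\<Phi> (r (insert i K) (a(i := b))))
          = fscale (\<Prod>j\<in>K. c j (a j) (y j)) (fscale (c i b (y i)) (\<Phi> ((r K a)(i := e i b))))"
        using insert.hyps by (simp add: upd[OF a] mult.commute)
    qed
    also have "\<dots> = (\<Sum>a\<in>PiE K A. fscale (\<Prod>j\<in>K. c j (a j) (y j))
             (\<Sum>b\<in>A i. fscale (c i b (y i)) (\<Phi> ((r K a)(i := e i b)))))"
      by (simp add: sum.cartesian_product[symmetric] fun_vs.scale_sum_right sum.swap[of _ _ "A i"])
    finally have eq: "(\<Sum>a\<in>PiE (insert i K) A. fscale (\<Prod>j\<in>insert i K. c j (a j) (y j))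
          (\<Phi> (r (insert i K) a))) = \<dots>" .
    \<comment> \<open>Coordinate \<open>i\<close> of \<open>r K a\<close> is still
      \<open>y i\<close>, so \<open>expand\<close> applies to every term with the coefficients that
      are wanted.\<close>
    have "(\<Sum>a\<in>PiE K A. fscale (\<Prod>j\<in>K. c j (a j) (y j))
        (\<Phi> (r K a) - (\<Sum>b\<in>A i. fscale (c i b (y i)) (\<Phi> ((r K a)(i := e i b)))))) \<in> N"
    proof (intro fun_vs.subspace_sum[OF N] fun_vs.subspace_scale[OF N])
      fix a assume a: "a \<in> PiE K A"
      have "r K a i = y i" using i by (simp add: r_def)
      then show "\<Phi> (r K a) - (\<Sum>b\<in>A i. fscale (c i b (y i)) (\<Phi> ((r K a)(i := e i b)))) \<in> N"
        using expand[OF rP[OF a] i(1)] by simp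
    qed
    then have "(\<Sum>a\<in>PiE K A. fscale (\<Prod>j\<in>K. c j (a j) (y j)) (\<Phi> (r K a)))
        - (\<Sum>a\<in>PiE K A. fscale (\<Prod>j\<in>K. c j (a j) (y j))
             (\<Sum>b\<in>A i. fscale (c i b (y i)) (\<Phi> ((r K a)(i := e i b))))) \<in> N"
      by (simp only: fun_vs.scale_right_diff_distrib sum_subtractf)
    note * = fun_vs.subspace_add[OF N this insert.IH[OF i(3)]]
    have telescope: "(u - v) + (z - u) = z - v" for u v z :: "'b \<Rightarrow> 'k"
      by (simp add: fun_eq_iff)
    show ?case
      using * unfolding eq telescope .
  qed
  note expansion = this[OF subset_refl]
  have "r J a = (\<lambda>j\<in>J. e j (a j))" for a
    using PiE_arb[OF y] by (simp add: r_def fun_eq_iff)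
  then show ?thesis
    using expansion by simp
qed


section \<open>Tensors and the external product\<close>

lemma free_gen_free_space:
  "t \<in> PiE J V \<Longrightarrow> (free_gen t :: _ \<Rightarrow> 'k::field) \<in> free_space J V"
  using finite_support_free_gen[of t, where 'k = 'k] by (auto simp: free_space_def free_gen_def)

lemma free_space_expand:
  fixes x :: "('i \<Rightarrow> 'v) \<Rightarrow> 'k::field"
  assumes "finite {t. x t \<noteq> 0}"
  shows "x = (\<Sum>t | x t \<noteq> 0. fscale (x t) (free_gen t))"
proof
  fix u
  have "(\<Sum>t | x t \<noteq> 0. fscale (x t) (free_gen t) u) = (\<Sum>t | x t \<noteq> 0. if u = t then x t else 0)"
    by (intro sum.cong refl) (simp only: fscale_def free_gen_def mult_1_right mult_zero_right split: if_split, simp)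
  also have "\<dots> = x u"
    using assms by simp
  finally show "x u = (\<Sum>t | x t \<noteq> 0. fscale (x t) (free_gen t)) u"
    by (simp only: sum_fun_apply)
qed

lemma ext_prod_image:
  assumes "finite P"
  shows "ext_prod I P ` tensor P V = prod_free I P ` free_space P V"
  unfolding tensor_def image_image by (intro image_cong refl ext_prod_coset assms)

text \<open>The tuples \<open>t a\<close> may coincide, so the coefficients of the sum of generators
  cannot be read off as \<open>c a\<close>; additivity of \<open>prod_free\<close> is used
  instead.\<close>

lemma prod_free_span:
  fixes t :: "'c \<Rightarrow> 'a set \<Rightarrow> ('a \<Rightarrow> real) set \<Rightarrow> 'k::field"
  assumes "finite A" "\<And>a. a \<in> A \<Longrightarrow> t a \<in> PiE P V"
  shows "(\<Sum>a\<in>A. fscale (c a) (prod_pure I P (t a))) \<in> prod_free I P ` free_space P V"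
proof
  let ?x = "\<Sum>a\<in>A. fscale (c a) (free_gen (t a))"
  note sub = free_space_subspace[of P V]
  show x: "?x \<in> free_space P V"
    by (intro fun_vs.subspace_sum[OF sub] fun_vs.subspace_scale[OF sub] free_gen_free_space assms)
  have "prod_free I P (\<Sum>a\<in>B. fscale (c a) (free_gen (t a)))
      = (\<Sum>a\<in>B. fscale (c a) (prod_pure I P (t a)))" if "finite B" for B
    using that
  proof induction
    case empty
    then show ?case by (simp add: prod_free_def)
  next
    case (insert b B)
    have g: "fscale (c a) (free_gen (t a)) \<in> {x :: _ \<Rightarrow> 'k. finite {u. x u \<noteq> 0}}" for a
      by (intro fun_vs.subspace_scale[OF finite_support_subspace] CollectI finite_support_free_gen)
    then have "(\<Sum>a\<in>B. fscale (c a) (free_gen (t a))) \<in> {x :: _ \<Rightarrow> 'k. finite {u. x u \<noteq> 0}}"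
      by (intro fun_vs.subspace_sum[OF finite_support_subspace])
    then have fin: "finite {u. (\<Sum>a\<in>B. fscale (c a) (free_gen (t a))) u \<noteq> 0}"
      by (rule CollectD)
    have fin': "finite {u. fscale (c b) (free_gen (t b)) u \<noteq> 0}"
      using g[of b] by (rule CollectD)
    show ?case
      unfolding sum.insert[OF insert.hyps] prod_free_add[OF fin' fin] insert.IH
      by (simp add: prod_free_scale finite_support_free_gen prod_free_gen)
  qed
  from this[OF assms(1)] show "(\<Sum>a\<in>A. fscale (c a) (prod_pure I P (t a))) = prod_free I P ?x" ..
qed

lemma dual_families:
  fixes V :: "'i \<Rightarrow> ('b \<Rightarrow> 'k::field) set"
  assumes "\<And>j. j \<in> J \<Longrightarrow> finite (\<Omega> j)" "\<And>j. j \<in> J \<Longrightarrow> fun_vs.subspace (V j)"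
    and "\<And>j v x. j \<in> J \<Longrightarrow> v \<in> V j \<Longrightarrow> x \<notin> \<Omega> j \<Longrightarrow> v x = 0"
  obtains A w where "\<And>j. j \<in> J \<Longrightarrow> A j \<subseteq> \<Omega> j"
    "\<And>j a. j \<in> J \<Longrightarrow> a \<in> A j \<Longrightarrow> w j a \<in> V j"
    "\<And>j v. j \<in> J \<Longrightarrow> v \<in> V j \<Longrightarrow> v = (\<Sum>a\<in>A j. fscale (v a) (w j a))"
proof -
  have "\<exists>A w. A \<subseteq> \<Omega> j \<and> (\<forall>a\<in>A. w a \<in> V j) \<and> (\<forall>v\<in>V j. v = (\<Sum>a\<in>A. fscale (v a) (w a)))"
    if "j \<in> J" for j
    by (rule dual_family_exists) (use assms that in blast)+
  then obtain A w where "\<forall>j\<in>J. A j \<subseteq> \<Omega> j \<and> (\<forall>a\<in>A j. w j a \<in> V j) \<and>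
      (\<forall>v\<in>V j. v = (\<Sum>a\<in>A j. fscale (v a) (w j a)))"
    by metis
  then show ?thesis
    by (intro that[of A w]) blast+
qed

lemma tensor_null_subspace: "fun_vs.subspace (tensor_null J V)"
  unfolding tensor_null_def by (rule fun_vs.subspace_span)

lemma free_gen_linear_mod_null:
  fixes V :: "'i \<Rightarrow> ('b \<Rightarrow> 'k::field) set"
  assumes t: "t \<in> PiE J V" and j: "j \<in> J" and V: "fun_vs.subspace (V j)"
    and "finite A" "\<And>a. a \<in> A \<Longrightarrow> w a \<in> V j"
  shows "free_gen (t(j := \<Sum>a\<in>A. fscale (c a) (w a)))
    - (\<Sum>a\<in>A. fscale (c a) (free_gen (t(j := w a)))) \<in> tensor_null J V"
  using assms(4,5)
proof (induction A rule: finite_induct)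
  case empty
  \<comment> \<open>The scaling relation with scalar 0 and vector 0: its second term vanishes, so
    the generator with 0 in slot \<open>j\<close> is itself a relation.\<close>
  have "free_gen (t(j := fscale 0 (0 :: 'b \<Rightarrow> 'k))) - fscale 0 (free_gen (t(j := 0))) \<in> multilinear_rels J V"
    unfolding multilinear_rels_def using t j fun_vs.subspace_0[OF V] by blast
  then show ?case
    unfolding tensor_null_def sum.empty fun_vs.scale_zero_left diff_0_right by (rule fun_vs.span_base)
next
  case (insert b A)
  let ?s = "\<Sum>a\<in>A. fscale (c a) (w a)" and ?g = "\<Sum>a\<in>A. fscale (c a) (free_gen (t(j := w a)))"
  let ?b = "fscale (c b) (w b)"
  have s: "?s \<in> V j" and b: "w b \<in> V j" "?b \<in> V j"
    using insert.prems by (auto intro!: fun_vs.subspace_sum[OF V] fun_vs.subspace_scale[OF V])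
  have "free_gen (t(j := ?b + ?s)) - free_gen (t(j := ?b)) - free_gen (t(j := ?s)) \<in> multilinear_rels J V"
    unfolding multilinear_rels_def using t j s b by blast
  then have 1: "free_gen (t(j := ?b + ?s)) - free_gen (t(j := ?b)) - free_gen (t(j := ?s)) \<in> tensor_null J V"
    unfolding tensor_null_def by (rule fun_vs.span_base)
  have "free_gen (t(j := ?b)) - fscale (c b) (free_gen (t(j := w b))) \<in> multilinear_rels J V"
    unfolding multilinear_rels_def using t j b by blast
  then have 2: "free_gen (t(j := ?b)) - fscale (c b) (free_gen (t(j := w b))) \<in> tensor_null J V"
    unfolding tensor_null_def by (rule fun_vs.span_base)
  have 3: "free_gen (t(j := ?s)) - ?g \<in> tensor_null J V"
    by (rule insert.IH) (rule insert.prems, blast)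
  have telescope: "(u - v - z) + ((v - p) + (z - q)) = u - (p + q)" for u v z p q :: "('i \<Rightarrow> 'b \<Rightarrow> 'k) \<Rightarrow> 'k"
    by (simp add: fun_eq_iff)
  show ?case
    using fun_vs.subspace_add[OF tensor_null_subspace 1 fun_vs.subspace_add[OF tensor_null_subspace 2 3]]
    unfolding telescope sum.insert[OF insert.hyps] .
qed

text \<open>Expanding every slot by its dual family writes \<open>x\<close>, modulo
  \<open>tensor_null\<close>, as a combination of the generators of tuples of vectors
  \<open>w B (a B)\<close>. The coefficient belonging to \<open>a\<close> is the value of
  \<open>prod_free I P x\<close> at a face whose restrictions are the \<open>a B\<close>;
  \<open>glue\<close> provides this face, and the value is 0.\<close>

lemma tensor_null_if_prod_free_eq_0:
  fixes V :: "'a set \<Rightarrow> (('a \<Rightarrow> real) set \<Rightarrow> 'k::field) set"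
  assumes P: "finite P" and sub: "\<And>B. B \<in> P \<Longrightarrow> fun_vs.subspace (V B)"
    and fin: "\<And>B. B \<in> P \<Longrightarrow> finite (\<Omega> B)"
    and supp: "\<And>B v X. B \<in> P \<Longrightarrow> v \<in> V B \<Longrightarrow> X \<notin> \<Omega> B \<Longrightarrow> v X = 0"
    and glue: "\<And>y. y \<in> PiE P \<Omega> \<Longrightarrow> \<exists>X\<in>faces I P. \<forall>B\<in>P. face_restrict I B X = y B"
    and x: "x \<in> free_space P V" "prod_free I P x = 0"
  shows "x \<in> tensor_null P V"
proof -
  let ?N = "tensor_null P V"
  obtain A w where A: "\<And>B. B \<in> P \<Longrightarrow> A B \<subseteq> \<Omega> B"
    and w: "\<And>B a. B \<in> P \<Longrightarrow> a \<in> A B \<Longrightarrow> w B a \<in> V B"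
    and dual: "\<And>B v. B \<in> P \<Longrightarrow> v \<in> V B \<Longrightarrow> v = (\<Sum>a\<in>A B. fscale (v a) (w B a))"
    by (rule dual_families[of P \<Omega> V], erule fin, erule sub, erule (2) supp, rule that)
  have finA: "finite (A B)" if "B \<in> P" for B
    using finite_subset[OF A fin] that by blast
  have gen: "free_gen t - (\<Sum>a\<in>PiE P A. fscale (\<Prod>B\<in>P. t B (a B)) (free_gen (\<lambda>B\<in>P. w B (a B)))) \<in> ?N"
    if t: "t \<in> PiE P V" for t :: "'a set \<Rightarrow> ('a \<Rightarrow> real) set \<Rightarrow> 'k"
  proof (rule multilinear_expansion[where c = "\<lambda>_ a v. v a" and Y = V, OF P tensor_null_subspace finA w _ t])
    fix y B assume y: "y \<in> PiE P V" and B: "B \<in> P"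
    have "y(B := \<Sum>a\<in>A B. fscale (y B a) (w B a)) = y"
      unfolding dual[OF B PiE_mem[OF y B], symmetric] by (rule fun_upd_triv)
    moreover have "free_gen (y(B := \<Sum>a\<in>A B. fscale (y B a) (w B a)))
        - (\<Sum>a\<in>A B. fscale (y B a) (free_gen (y(B := w B a)))) \<in> ?N"
      by (rule free_gen_linear_mod_null[OF y B sub[OF B] finA[OF B] w[OF B]])
    ultimately show "free_gen y - (\<Sum>a\<in>A B. fscale (y B a) (free_gen (y(B := w B a)))) \<in> ?N"
      by (simp only:)
  qed
  let ?S = "{t. x t \<noteq> 0}"
  have S: "finite ?S" "\<And>t. t \<in> ?S \<Longrightarrow> t \<in> PiE P V"
    using x(1) by (auto simp: free_space_def)
  have "(\<Sum>t\<in>?S. fscale (x t) (free_gen t -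
      (\<Sum>a\<in>PiE P A. fscale (\<Prod>B\<in>P. t B (a B)) (free_gen (\<lambda>B\<in>P. w B (a B)))))) \<in> ?N"
    using S(2) by (intro fun_vs.subspace_sum[OF tensor_null_subspace]
        fun_vs.subspace_scale[OF tensor_null_subspace] gen)
  also have "(\<Sum>t\<in>?S. fscale (x t) (free_gen t -
      (\<Sum>a\<in>PiE P A. fscale (\<Prod>B\<in>P. t B (a B)) (free_gen (\<lambda>B\<in>P. w B (a B))))))
    = x - (\<Sum>a\<in>PiE P A. fscale (\<Sum>t\<in>?S. x t * (\<Prod>B\<in>P. t B (a B))) (free_gen (\<lambda>B\<in>P. w B (a B))))"
    by (simp only: fun_vs.scale_right_diff_distrib sum_subtractf free_space_expand[OF S(1), symmetric]
        fun_vs.scale_sum_right fun_vs.scale_sum_left fun_vs.scale_scale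
        sum.swap[of _ "PiE P A" ?S])
  also have "(\<Sum>a\<in>PiE P A. fscale (\<Sum>t\<in>?S. x t * (\<Prod>B\<in>P. t B (a B))) (free_gen (\<lambda>B\<in>P. w B (a B)))) = 0"
  proof (intro sum.neutral ballI)
    fix a assume "a \<in> PiE P A"
    then have "a \<in> PiE P \<Omega>" using A by (auto simp: PiE_iff)
    then obtain X where X: "X \<in> faces I P" "\<forall>B\<in>P. face_restrict I B X = a B"
      using glue by blast
    have "(\<Sum>t\<in>?S. x t * (\<Prod>B\<in>P. t B (a B))) = prod_free I P x X"
      unfolding prod_free_def sum_fun_apply
      using X by (intro sum.cong refl) (simp add: fscale_def prod_pure_def)
    then show "fscale (\<Sum>t\<in>?S. x t * (\<Prod>B\<in>P. t B (a B))) (free_gen (\<lambda>B\<in>P. w B (a B))) = 0"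
      using x(2) by simp
  qed
  finally show ?thesis by simp
qed

text \<open>For two factors this is the identity \<open>(V1 \<otimes> F2) \<inter> (F1 \<otimes> V2)
  = V1 \<otimes> V2\<close>, where \<open>F1\<close> and \<open>F2\<close> are the spaces of all
  functions on the two finite sets. It is applied with all functionals as factors, for
  semisimplicity, and with the spaces \<open>Gam\<close>.\<close>

lemma prod_free_surj:
  fixes V :: "'a set \<Rightarrow> (('a \<Rightarrow> real) set \<Rightarrow> 'k::field) set"
  assumes P: "finite P" and sub: "\<And>B. B \<in> P \<Longrightarrow> fun_vs.subspace (V B)"
    and fin: "\<And>B. B \<in> P \<Longrightarrow> finite (\<Omega> B)"
    and supp: "\<And>B v X. B \<in> P \<Longrightarrow> v \<in> V B \<Longrightarrow> X \<notin> \<Omega> B \<Longrightarrow> v X = 0"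
    and restr: "\<And>B X. B \<in> P \<Longrightarrow> X \<in> faces I P \<Longrightarrow> face_restrict I B X \<in> \<Omega> B"
    and f: "f \<in> functionals I P"
    and \<Phi>: "\<And>X. X \<in> faces I P \<Longrightarrow> f X = \<Phi> (\<lambda>B\<in>P. face_restrict I B X)"
    and slice: "\<And>y B. y \<in> PiE P \<Omega> \<Longrightarrow> B \<in> P \<Longrightarrow>
      (\<lambda>Z. if Z \<in> \<Omega> B then \<Phi> (y(B := Z)) else 0) \<in> V B"
  shows "f \<in> prod_free I P ` free_space P V"
proof -
  obtain A w where A: "\<And>B. B \<in> P \<Longrightarrow> A B \<subseteq> \<Omega> B"
    and w: "\<And>B a. B \<in> P \<Longrightarrow> a \<in> A B \<Longrightarrow> w B a \<in> V B"
    and dual: "\<And>B v. B \<in> P \<Longrightarrow> v \<in> V B \<Longrightarrow> v = (\<Sum>a\<in>A B. fscale (v a) (w B a))"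
    by (rule dual_families[of P \<Omega> V], erule fin, erule sub, erule (2) supp, rule that)
  have finA: "finite (A B)" if "B \<in> P" for B
    using finite_subset[OF A fin] that by blast
  \<comment> \<open>\<open>multilinear_expansion\<close> is about function-valued maps, so scalars
    become functions on a one-point type; modulo \<open>{0}\<close> it gives an equality.\<close>
  let ?\<Phi> = "\<lambda>y (_::unit). \<Phi> y"
  have expand: "?\<Phi> y - (\<Sum>a\<in>PiE P A. fscale (\<Prod>B\<in>P. w B (a B) (y B)) (?\<Phi> (\<lambda>B\<in>P. a B))) \<in> {0}"
    if y: "y \<in> PiE P \<Omega>" for y
  proof (rule multilinear_expansion[where c = w and Y = \<Omega> and e = "\<lambda>_ a. a", OF P fun_vs.subspace_single_0 finA _ _ y])
    show "a \<in> \<Omega> B" if "B \<in> P" "a \<in> A B" for B a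
      using A that by blast
    fix y B assume y: "y \<in> PiE P \<Omega>" and B: "B \<in> P"
    \<comment> \<open>The slice through \<open>y\<close> takes the value \<open>\<Phi> y\<close> at
      \<open>y B\<close>, so its dual expansion, evaluated there, is the expansion of
      \<open>\<Phi>\<close> in the variable \<open>B\<close>.\<close>
    have "(\<lambda>Z. if Z \<in> \<Omega> B then \<Phi> (y(B := Z)) else 0) (y B)
        = (\<Sum>a\<in>A B. fscale (if a \<in> \<Omega> B then \<Phi> (y(B := a)) else 0) (w B a)) (y B)"
      using dual[OF B slice[OF y B]] by (rule fun_cong)
    also have "\<dots> = (\<Sum>a\<in>A B. w B a (y B) * \<Phi> (y(B := a)))"
      unfolding sum_fun_apply using A[OF B] by (intro sum.cong) (auto simp: fscale_def)
    finally have "\<Phi> y = (\<Sum>a\<in>A B. w B a (y B) * \<Phi> (y(B := a)))"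
      using PiE_mem[OF y B] by simp
    then show "?\<Phi> y - (\<Sum>a\<in>A B. fscale (w B a (y B)) (?\<Phi> (y(B := a)))) \<in> {0}"
      by (simp add: fun_eq_iff sum_fun_apply fscale_def)
  qed
  have "f = (\<Sum>a\<in>PiE P A. fscale (\<Phi> a) (prod_pure I P (\<lambda>B\<in>P. w B (a B))))"
  proof
    fix X
    show "f X = (\<Sum>a\<in>PiE P A. fscale (\<Phi> a) (prod_pure I P (\<lambda>B\<in>P. w B (a B)))) X"
    proof (cases "X \<in> faces I P")
      case False
      then show ?thesis using f by (simp add: functionals_def sum_fun_apply fscale_def prod_pure_def)
    next
      case True
      let ?y = "\<lambda>B\<in>P. face_restrict I B X"
      have y: "?y \<in> PiE P \<Omega>" using restr True by auto
      have "?\<Phi> ?y = (\<Sum>a\<in>PiE P A. fscale (\<Prod>B\<in>P. w B (a B) (?y B)) (?\<Phi> (\<lambda>B\<in>P. a B)))"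
        using expand[OF y] by simp
      then have "\<Phi> ?y = (\<Sum>a\<in>PiE P A. fscale (\<Prod>B\<in>P. w B (a B) (?y B)) (?\<Phi> (\<lambda>B\<in>P. a B))) ()"
        by (rule fun_cong)
      also have "\<dots> = (\<Sum>a\<in>PiE P A. fscale (\<Phi> a) (prod_pure I P (\<lambda>B\<in>P. w B (a B))) X)"
        unfolding sum_fun_apply
        using True by (intro sum.cong refl) (simp add: fscale_def prod_pure_def PiE_restrict mult.commute)
      finally show ?thesis using \<Phi>[OF True] by (simp add: sum_fun_apply)
    qed
  qed
  also have "\<dots> \<in> prod_free I P ` free_space P V"
    using w by (intro prod_free_span finite_PiE P finA) auto
  finally show ?thesis .
qed

section \<open>Points of faces\<close>

lemma partition_on_eqI:
  assumes "partition_on I Q" "K \<in> Q" "L \<in> Q" "K \<inter> L \<noteq> {}"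
  shows "K = L"
  using assms unfolding partition_on_def disjoint_def by blast

lemma partition_on_block:
  assumes "partition_on I Q" "K \<in> Q"
  shows "K \<subseteq> I" "K \<noteq> {}"
  using assms unfolding partition_on_def by blast+

lemma partition_on_obtain:
  assumes "partition_on I Q" "i \<in> I"
  obtains K where "K \<in> Q" "i \<in> K"
  using assms unfolding partition_on_def by blast

definition face_of :: "'a set \<Rightarrow> ('a \<Rightarrow> real) \<Rightarrow> ('a \<Rightarrow> real) set"
  where "face_of I h = face_of_sign I (\<lambda>S. sgn (sum h S))"

text \<open>For a partition \<open>Q\<close> of a finite \<open>I\<close> and
  \<open>S \<subseteq> I\<close>: the set \<open>S\<close> is a union of blocks of \<open>Q\<close>,
  or equivalently the sum over \<open>S\<close> vanishes on all of \<open>Tv I Q\<close>.\<close>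

abbreviation saturated :: "'a set set \<Rightarrow> 'a set \<Rightarrow> bool"
  where "saturated Q S \<equiv> \<forall>B\<in>Q. B \<subseteq> S \<or> B \<inter> S = {}"

text \<open>The only hyperplanes of the arrangement through \<open>h\<close> are those containing
  \<open>Tv I Q\<close>. For finite \<open>I\<close> and a partition \<open>Q\<close>, these are the
  points of the faces with support \<open>Tv I Q\<close>.\<close>

definition generic :: "'a set \<Rightarrow> 'a set set \<Rightarrow> ('a \<Rightarrow> real) \<Rightarrow> bool"
  where "generic I Q h \<longleftrightarrow> h \<in> Tv I Q \<and>
    (\<forall>S\<subseteq>I. sum h S = 0 \<longrightarrow> saturated Q S)"

definition point_restrict :: "'a set \<Rightarrow> ('a \<Rightarrow> real) \<Rightarrow> 'a \<Rightarrow> real"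
  where "point_restrict B h = (\<lambda>i. if i \<in> B then h i else 0)"

lemma sum_point_restrict: "finite S \<Longrightarrow> sum (point_restrict B h) S = sum h (S \<inter> B)"
  unfolding point_restrict_def by (rule sum.inter_restrict[symmetric])

lemma sum_blocks_eq_0:
  assumes "finite I" "partition_on I Q" "h \<in> Tv I Q" "S \<subseteq> I" "\<And>B. B \<in> Q \<Longrightarrow> B \<subseteq> S \<or> B \<inter> S = {}"
  shows "sum h S = 0"
proof -
  let ?R = "{B \<in> Q. B \<subseteq> S}"
  have "S = \<Union>?R"
  proof
    show "S \<subseteq> \<Union>?R"
    proof
      fix i assume i: "i \<in> S"
      then obtain B where "B \<in> Q" "i \<in> B"
        using assms(2,4) by (auto simp: partition_on_def)
      with assms(5)[of B] i show "i \<in> \<Union>?R" by blast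
    qed
  qed blast
  moreover have "sum h (\<Union>?R) = (sum \<circ> sum) h ?R"
  proof (rule sum.Union_disjoint)
    show "\<forall>A\<in>?R. finite A"
      using finite_subset[OF _ finite_subset[OF assms(4,1)]] by blast
    show "\<forall>A\<in>?R. \<forall>B\<in>?R. A \<noteq> B \<longrightarrow> A \<inter> B = {}"
      using assms(2) by (simp add: partition_on_def disjoint_def)
  qed
  moreover have "(sum \<circ> sum) h ?R = 0"
    unfolding comp_def using assms(3) by (intro sum.neutral) (simp add: Tv_def)
  ultimately show ?thesis by (simp only:)
qed

lemma generic_sum_eq_0_iff:
  assumes "finite I" "partition_on I Q" "generic I Q h" "S \<subseteq> I"
  shows "sum h S = 0 \<longleftrightarrow> saturated Q S"
  using assms sum_blocks_eq_0[of I Q h S] unfolding generic_def by blast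

lemma Tv_subspace: "fun_vs.subspace (Tv I P)"
  by (rule fun_vs.subspaceI) (auto simp: Tv_def fscale_def sum.distrib sum_distrib_left[symmetric])

lemma Tv_subset_Tv_single:
  assumes "finite I" "partition_on I Q"
  shows "Tv I Q \<subseteq> Tv I {I}"
proof
  fix h assume h: "h \<in> Tv I Q"
  have "sum h I = 0"
    by (rule sum_blocks_eq_0[OF assms h subset_refl]) (use assms(2) in \<open>auto simp: partition_on_def\<close>)
  with h show "h \<in> Tv I {I}" by (simp add: Tv_def)
qed

lemma face_of_sign_cong:
  "(\<And>S. S \<noteq> {} \<Longrightarrow> S \<subset> I \<Longrightarrow> s S = s' S) \<Longrightarrow> face_of_sign I s = face_of_sign I s'"
  unfolding face_of_sign_def by (intro Collect_cong conj_cong refl all_cong) auto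

lemma face_of_cong:
  "(\<And>S. S \<subseteq> I \<Longrightarrow> sgn (sum h S) = sgn (sum h' S)) \<Longrightarrow> face_of I h = face_of I h'"
  unfolding face_of_def by (rule face_of_sign_cong) auto

lemma mem_face_of: "h \<in> Tv I {I} \<Longrightarrow> h \<in> face_of I h"
  by (simp add: face_of_def face_of_sign_def)

text \<open>A face prescribes signs only for nonempty proper subsets; for \<open>{}\<close> and
  \<open>I\<close> both sums are 0.\<close>

lemma sgn_sum_face_of:
  assumes "g \<in> face_of I h" "h \<in> Tv I {I}" "S \<subseteq> I"
  shows "sgn (sum g S) = sgn (sum h S)"
proof -
  consider "S = {}" | "S = I" | "S \<noteq> {}" "S \<subset> I" using assms(3) by blast
  then show ?thesis
    using assms by cases (auto simp: face_of_def face_of_sign_def Tv_def)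
qed

lemma face_sign_face_of:
  assumes "h \<in> Tv I {I}" "S \<subseteq> I"
  shows "face_sign (face_of I h) S = sgn (sum h S)"
proof -
  have "(\<lambda>g. sgn (sum g S)) ` face_of I h = {sgn (sum h S)}"
  proof (intro equalityI image_subsetI subsetI)
    show "sgn (sum g S) \<in> {sgn (sum h S)}" if "g \<in> face_of I h" for g
      unfolding singleton_iff by (rule sgn_sum_face_of[OF that assms])
    show "x \<in> (\<lambda>g. sgn (sum g S)) ` face_of I h" if "x \<in> {sgn (sum h S)}" for x
      using that mem_face_of[OF assms(1)] by blast
  qed
  then show ?thesis by (simp add: face_sign_def)
qed

text \<open>As \<open>e\<close> tends to 0 from the right, the sum of \<open>h\<close> dominates
  unless it is 0. There are finitely many \<open>S\<close>, so one \<open>e\<close> serves them all,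
  and the signs become the lexicographic signs of the pair of sums.\<close>

lemma perturbation:
  fixes h g :: "'a \<Rightarrow> real"
  assumes "finite I"
  shows "\<exists>e>0. \<forall>S\<subseteq>I. sgn (sum (h + fscale e g) S) = (if sum h S \<noteq> 0 then sgn (sum h S) else sgn (sum g S))"
proof -
  have *: "sum (h + fscale e g) S = sum h S + e * sum g S" for e S
    by (simp add: fscale_def sum.distrib sum_distrib_left)
  have "\<forall>\<^sub>F e in at_right 0. sgn (sum h S + e * sum g S)
      = (if sum h S \<noteq> 0 then sgn (sum h S) else sgn (sum g S))" for S
  proof -
    have pos: "\<forall>\<^sub>F e in at_right 0. e > (0::real)"
      by (simp add: eventually_at_right_less)
    have lim: "((\<lambda>e. sum h S + e * sum g S) \<longlongrightarrow> sum h S + 0 * sum g S) (at_right 0)"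
      by (intro tendsto_intros)
    consider "sum h S > 0" | "sum h S < 0" | "sum h S = 0" by linarith
    then show ?thesis
    proof cases
      case 1
      then show ?thesis
        using order_tendstoD(1)[OF lim, of 0] by (auto elim!: eventually_mono)
    next
      case 2
      then show ?thesis
        using order_tendstoD(2)[OF lim, of 0] by (auto elim!: eventually_mono)
    next
      case 3
      then show ?thesis
        by (intro eventually_mono[OF pos]) (simp add: sgn_mult)
    qed
  qed
  then have "\<forall>\<^sub>F e in at_right 0. \<forall>S\<in>Pow I. sgn (sum h S + e * sum g S)
      = (if sum h S \<noteq> 0 then sgn (sum h S) else sgn (sum g S))"
    using assms by (intro eventually_ball_finite) auto
  with eventually_at_right_less[of "0::real"]
  have "\<forall>\<^sub>F e in at_right 0. e > (0::real) \<and> (\<forall>S\<in>Pow I. sgn (sum h S + e * sum g S)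
      = (if sum h S \<noteq> 0 then sgn (sum h S) else sgn (sum g S)))"
    by (rule eventually_conj)
  then have "\<exists>e>0. \<forall>S\<in>Pow I. sgn (sum h S + e * sum g S)
      = (if sum h S \<noteq> 0 then sgn (sum h S) else sgn (sum g S))"
    by (intro eventually_happens'[of "at_right (0::real)"]) simp_all
  then show ?thesis unfolding * Ball_def Pow_iff .
qed

text \<open>Signs are constant on a face, so a hyperplane through one of its points contains the
  face and hence its span. Conversely, a generic point can be moved a little in any direction of
  \<open>Tv I Q\<close> without leaving its face, so the face spans \<open>Tv I Q\<close>.\<close>

lemma mem_faces_iff:
  assumes I: "finite I" and Q: "partition_on I Q"
  shows "X \<in> faces I Q \<longleftrightarrow> (\<exists>h. generic I Q h \<and> X = face_of I h)"
proof
  assume X: "X \<in> faces I Q"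
  then have span: "fun_vs.span X = Tv I Q" by (simp add: faces_def)
  obtain s h where s: "X = face_of_sign I s" "h \<in> X"
    using X by (auto simp: faces_def adjoint_faces_def)
  have h: "h \<in> Tv I Q"
    using s(2) span fun_vs.span_base by blast
  have "X = face_of I h"
    unfolding s(1) face_of_def using s by (intro face_of_sign_cong) (simp add: face_of_sign_def)
  moreover have "B \<subseteq> S \<or> B \<inter> S = {}" if S: "S \<subseteq> I" "sum h S = 0" and B: "B \<in> Q" for S B
  proof (rule ccontr)
    assume "\<not> (B \<subseteq> S \<or> B \<inter> S = {})"
    then obtain b c where bc: "b \<in> B" "b \<in> S" "c \<in> B" "c \<notin> S" by blast
    have BI: "B \<subseteq> I" using Q B by (auto simp: partition_on_def)
    have "S \<noteq> {}" "S \<subset> I" using bc BI S(1) by auto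
    then have "sgn (sum h S) = s S"
      using s unfolding face_of_sign_def by blast
    then have "s S = 0"
      using S(2) by simp
    have "X \<subseteq> {g. sum g S = 0}"
    proof
      fix g assume "g \<in> X"
      then have "sgn (sum g S) = s S"
        using s(1) \<open>S \<noteq> {}\<close> \<open>S \<subset> I\<close> unfolding face_of_sign_def by blast
      then show "g \<in> {g. sum g S = 0}"
        using \<open>s S = 0\<close> by (simp add: sgn_zero_iff)
    qed
    moreover have "fun_vs.subspace {g. sum g S = (0::real)}"
      by (rule fun_vs.subspaceI) (auto simp: fscale_def sum.distrib sum_distrib_left[symmetric])
    ultimately have vanish: "Tv I Q \<subseteq> {g. sum g S = 0}"
      unfolding span[symmetric] by (rule fun_vs.span_minimal)
    \<comment> \<open>\<open>b\<close> and \<open>c\<close> lie in the same block, so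
      \<open>g\<close> is in \<open>Tv I Q\<close>; but \<open>S\<close> contains only
      \<open>b\<close>, so the sum of \<open>g\<close> over \<open>S\<close> is 1.\<close>
    define g :: "'a \<Rightarrow> real" where "g = (\<lambda>i. (if i = b then 1 else 0) - (if i = c then 1 else 0))"
    have fin: "finite T" if "T \<subseteq> I" for T using I that finite_subset by blast
    have sum_g: "sum g T = (if b \<in> T then 1 else 0) - (if c \<in> T then 1 else 0)" if "T \<subseteq> I" for T
      using fin[OF that] by (simp add: g_def sum_subtractf)
    have "b \<in> T \<longleftrightarrow> c \<in> T" if "T \<in> Q" for T
      using partition_on_eqI[OF Q that B] bc(1,3) by blast
    moreover have "T \<subseteq> I" if "T \<in> Q" for T
      using Q that by (auto simp: partition_on_def)
    ultimately have "sum g T = 0" if "T \<in> Q" for T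
      using that sum_g[of T] by simp
    moreover have "g i = 0" if "i \<notin> I" for i
      using that bc BI by (auto simp: g_def)
    ultimately have "g \<in> Tv I Q"
      by (simp add: Tv_def)
    then show False
      using vanish sum_g[OF S(1)] bc by auto
  qed
  ultimately show "\<exists>h. generic I Q h \<and> X = face_of I h"
    using h unfolding generic_def by blast
next
  assume "\<exists>h. generic I Q h \<and> X = face_of I h"
  then obtain h where h: "generic I Q h" and X: "X = face_of I h" by blast
  have hQ: "h \<in> Tv I Q" using h by (simp add: generic_def)
  then have hI: "h \<in> Tv I {I}" using Tv_subset_Tv_single[OF I Q] by blast
  have hX: "h \<in> X" unfolding X by (rule mem_face_of[OF hI])
  have "X \<subseteq> Tv I Q"
  proof
    fix g assume g: "g \<in> X"
    have "sum g B = 0" if "B \<in> Q" for B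
    proof -
      have "B \<subseteq> I" using Q that by (auto simp: partition_on_def)
      then have "sgn (sum g B) = sgn (sum h B)"
        using sgn_sum_face_of g hI X by blast
      then show ?thesis using hQ that by (simp add: Tv_def sgn_zero_iff)
    qed
    then show "g \<in> Tv I Q" using g by (auto simp: X face_of_def face_of_sign_def Tv_def)
  qed
  then have "fun_vs.span X \<subseteq> Tv I Q"
    by (rule fun_vs.span_minimal[OF _ Tv_subspace])
  moreover have "g \<in> fun_vs.span X" if g: "g \<in> Tv I Q" for g
  proof -
    obtain e where e: "e > 0" and sg: "\<forall>S\<subseteq>I. sgn (sum (h + fscale e g) S)
        = (if sum h S \<noteq> 0 then sgn (sum h S) else sgn (sum g S))"
      using perturbation[OF I] by blast
    have gI: "g \<in> Tv I {I}" using g Tv_subset_Tv_single[OF I Q] by blast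
    have "sgn (sum (h + fscale e g) S) = sgn (sum h S)" if "S \<subseteq> I" for S
    proof (cases "sum h S = 0")
      case True
      then have "sum g S = 0"
        using sum_blocks_eq_0[OF I Q g that] generic_sum_eq_0_iff[OF I Q h that] by blast
      then show ?thesis using sg that True by simp
    qed (use sg that in simp)
    moreover have "h + fscale e g \<in> Tv I {I}"
      by (intro fun_vs.subspace_add[OF Tv_subspace] fun_vs.subspace_scale[OF Tv_subspace] hI gI)
    ultimately have "h + fscale e g \<in> X"
      unfolding X face_of_def face_of_sign_def by blast
    then have "fscale (1 / e) ((h + fscale e g) - h) \<in> fun_vs.span X"
      using hX by (intro fun_vs.span_scale fun_vs.span_diff fun_vs.span_base)
    also have "fscale (1 / e) ((h + fscale e g) - h) = g"
      using e by (simp add: fscale_def fun_eq_iff)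
    finally show ?thesis .
  qed
  ultimately have "fun_vs.span X = Tv I Q" by blast
  moreover have "X \<in> adjoint_faces I"
    using hX by (auto simp: adjoint_faces_def X face_of_def)
  ultimately show "X \<in> faces I Q" by (simp add: faces_def)
qed

lemma generic_imp_Tv: "finite I \<Longrightarrow> partition_on I Q \<Longrightarrow> generic I Q h \<Longrightarrow> h \<in> Tv I {I}"
  using Tv_subset_Tv_single unfolding generic_def by blast

text \<open>A face is determined by the signs at one of its points; truncating the sign function to
  \<open>Pow I\<close> leaves finitely many candidates.\<close>

lemma finite_faces:
  assumes "finite I"
  shows "finite (faces I Q)"
proof -
  have "faces I Q \<subseteq> face_of_sign I ` (Pow I \<rightarrow>\<^sub>E {-1, 0, 1})"
  proof
    fix X assume "X \<in> faces I Q"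
    then obtain s h where s: "X = face_of_sign I s" "h \<in> X"
      by (auto simp: faces_def adjoint_faces_def)
    have "X = face_of_sign I (\<lambda>S\<in>Pow I. sgn (sum h S))"
      unfolding s(1) using s by (intro face_of_sign_cong) (auto simp: face_of_sign_def)
    moreover have "(\<lambda>S\<in>Pow I. sgn (sum h S)) \<in> Pow I \<rightarrow>\<^sub>E {-1, 0, 1}"
      by (auto simp: sgn_if)
    ultimately show "X \<in> face_of_sign I ` (Pow I \<rightarrow>\<^sub>E {-1, 0, 1})" by blast
  qed
  moreover have "finite (face_of_sign I ` (Pow I \<rightarrow>\<^sub>E {-1, 0, 1}))"
    using assms by (intro finite_imageI finite_PiE) auto
  ultimately show ?thesis by (rule finite_subset)
qed

section \<open>Restrictions and cuts of faces\<close>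

text \<open>If \<open>B\<close> is a union of blocks of \<open>Q\<close>, this partition describes
  the support of the restriction to \<open>B\<close> of a face supported on \<open>Tv I Q\<close>.
  For a block it is \<open>single_block I B\<close>; the general form is needed because cuts break
  blocks up and because complements \<open>I - B\<close> are restricted to as well.\<close>

definition part_restrict :: "'a set \<Rightarrow> 'a set set \<Rightarrow> 'a set \<Rightarrow> 'a set set"
  where "part_restrict I Q B = {K \<in> Q. K \<subseteq> B} \<union> (\<lambda>i. {i}) ` (I - B)"

lemma saturated_block:
  assumes "partition_on I Q" "K \<in> Q"
  shows "saturated Q K"
  using partition_on_eqI[OF assms(1) _ assms(2)] by blast

lemma partition_on_part_restrict:
  assumes Q: "partition_on I Q" and B: "saturated Q B" "B \<subseteq> I"
  shows "partition_on I (part_restrict I Q B)"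
proof (rule partition_onI)
  have "\<Union>{K \<in> Q. K \<subseteq> B} = B"
  proof
    show "B \<subseteq> \<Union>{K \<in> Q. K \<subseteq> B}"
    proof
      fix i assume i: "i \<in> B"
      obtain K where "K \<in> Q" "i \<in> K"
        using partition_on_obtain[OF Q] i B(2) by blast
      then show "i \<in> \<Union>{K \<in> Q. K \<subseteq> B}" using B(1) i by blast
    qed
  qed blast
  then show "\<Union>(part_restrict I Q B) = I"
    using B(2) unfolding part_restrict_def by auto
  show "{} \<notin> part_restrict I Q B"
    using partition_on_block(2)[OF Q] unfolding part_restrict_def by blast
  show "disjnt K L" if "K \<in> part_restrict I Q B" "L \<in> part_restrict I Q B" "K \<noteq> L" for K L
    using that partition_on_eqI[OF Q, of K L] unfolding part_restrict_def disjnt_def by blast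
qed

lemma part_restrict_block:
  assumes "partition_on I P" "B \<in> P"
  shows "part_restrict I P B = single_block I B"
proof -
  have "K = B" if "K \<in> P" "K \<subseteq> B" for K
    using partition_on_eqI[OF assms(1) that(1) assms(2)] partition_on_block[OF assms(1) that(1)] that(2) by blast
  then have "{K \<in> P. K \<subseteq> B} = {B}" using assms(2) by blast
  then show ?thesis by (simp add: part_restrict_def single_block_def)
qed

text \<open>The restricted point sums over \<open>S\<close> to the sum of \<open>h\<close> over
  \<open>S \<inter> B\<close>. If this is 0, then \<open>S \<inter> B\<close>, and with it
  \<open>S\<close>, splits no block inside \<open>B\<close>; the singletons outside are never
  split.\<close>

lemma generic_point_restrict:
  assumes I: "finite I" and B: "B \<subseteq> I" and h: "generic I Q h"
  shows "generic I (part_restrict I Q B) (point_restrict B h)"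
proof -
  have "sum (point_restrict B h) K = 0" if K: "K \<in> part_restrict I Q B" for K
  proof -
    consider "K \<in> Q" "K \<subseteq> B" | i where "K = {i}" "i \<notin> B"
      using K by (auto simp: part_restrict_def)
    then show ?thesis
    proof cases
      case 1
      then have "finite K" "K \<inter> B = K" using finite_subset[OF subset_trans[OF _ B] I] by auto
      then show ?thesis
        using h 1 by (simp add: sum_point_restrict generic_def Tv_def)
    qed (simp add: point_restrict_def)
  qed
  moreover have "saturated (part_restrict I Q B) S" if S: "S \<subseteq> I" "sum (point_restrict B h) S = 0" for S
  proof -
    have "sum h (S \<inter> B) = 0"
      using S(2) sum_point_restrict[OF finite_subset[OF S(1) I], of B h] by simp
    then have "saturated Q (S \<inter> B)"
      using h S(1) unfolding generic_def by blast
    then show ?thesis unfolding part_restrict_def by blast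
  qed
  moreover have "point_restrict B h i = 0" if "i \<notin> I" for i
    using that B by (auto simp: point_restrict_def)
  ultimately show ?thesis by (simp add: generic_def Tv_def)
qed

lemma face_restrict_face_of:
  assumes I: "finite I" and B: "B \<subseteq> I" and h: "h \<in> Tv I {I}"
  shows "face_restrict I B (face_of I h) = face_of I (point_restrict B h)"
  unfolding face_restrict_def face_of_def[of I "point_restrict B h"]
proof (rule face_of_sign_cong)
  fix S assume S: "S \<noteq> {}" "S \<subset> I"
  then have "finite S" using finite_subset[OF psubset_imp_subset I] by simp
  moreover have "face_sign (face_of I h) (S \<inter> B) = sgn (sum h (S \<inter> B))"
    by (rule face_sign_face_of[OF h]) (use B in blast)
  ultimately show "(if S \<inter> B \<noteq> {} then face_sign (face_of I h) (S \<inter> B) else 0)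
      = sgn (sum (point_restrict B h) S)"
    by (simp add: sum_point_restrict)
qed

lemma face_restrict_in_faces:
  assumes I: "finite I" and Q: "partition_on I Q" and B: "saturated Q B" "B \<subseteq> I" and X: "X \<in> faces I Q"
  shows "face_restrict I B X \<in> faces I (part_restrict I Q B)"
proof -
  obtain h where h: "generic I Q h" "X = face_of I h"
    using X mem_faces_iff[OF I Q] by blast
  then show ?thesis
    unfolding mem_faces_iff[OF I partition_on_part_restrict[OF Q B]]
    using generic_point_restrict[OF I B(2) h(1)] face_restrict_face_of[OF I B(2) generic_imp_Tv[OF I Q h(1)]]
    by blast
qed

lemma face_restrict_face_restrict:
  assumes I: "finite I" and Q: "partition_on I Q" and B: "saturated Q B" "B \<subseteq> I"
    and X: "X \<in> faces I Q" and K: "K \<subseteq> I"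
  shows "face_restrict I K (face_restrict I B X) = face_restrict I (K \<inter> B) X"
proof -
  obtain h where h: "generic I Q h" "X = face_of I h"
    using X mem_faces_iff[OF I Q] by blast
  have "point_restrict B h \<in> Tv I {I}"
    by (rule generic_imp_Tv[OF I partition_on_part_restrict[OF Q B] generic_point_restrict[OF I B(2) h(1)]])
  moreover have "point_restrict K (point_restrict B h) = point_restrict (K \<inter> B) h"
    by (auto simp: point_restrict_def)
  moreover have "K \<inter> B \<subseteq> I" using K by blast
  ultimately show ?thesis
    unfolding h(2) using face_restrict_face_of[OF I] generic_imp_Tv[OF I Q h(1)] B(2) K by metis
qed

lemma generic_part_restrict_eq_0:
  assumes "generic I (part_restrict I Q B) h" "i \<notin> B"
  shows "h i = 0"
proof (cases "i \<in> I")
  case True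
  then have "{i} \<in> part_restrict I Q B"
    using assms(2) by (simp add: part_restrict_def)
  then have "sum h {i} = 0"
    using assms(1) unfolding generic_def Tv_def by blast
  then show ?thesis by simp
qed (use assms(1) in \<open>simp add: generic_def Tv_def\<close>)

text \<open>The representatives \<open>h\<close> and \<open>g\<close> live on \<open>B\<close> and
  on \<open>I - B\<close>. Their plain sum need not be generic, because their sums over some
  \<open>S\<close> may cancel; with a small factor \<open>e\<close> a vanishing sum forces both
  parts to vanish.\<close>

lemma faces_glue:
  assumes I: "finite I" and Q: "partition_on I Q" and B: "saturated Q B" "B \<subseteq> I"
    and Z: "Z \<in> faces I (part_restrict I Q B)" and Z': "Z' \<in> faces I (part_restrict I Q (I - B))"
  shows "\<exists>X\<in>faces I Q. face_restrict I B X = Z \<and> face_restrict I (I - B) X = Z'"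
proof -
  have B': "saturated Q (I - B)" "I - B \<subseteq> I"
    using B partition_on_block(1)[OF Q] by blast+
  note R = partition_on_part_restrict[OF Q B] and R' = partition_on_part_restrict[OF Q B']
  obtain h where h: "generic I (part_restrict I Q B) h" "Z = face_of I h"
    using Z mem_faces_iff[OF I R] by blast
  obtain g where g: "generic I (part_restrict I Q (I - B)) g" "Z' = face_of I g"
    using Z' mem_faces_iff[OF I R'] by blast
  obtain e where e: "e > 0" and sg: "\<forall>S\<subseteq>I. sgn (sum (h + fscale e g) S)
      = (if sum h S \<noteq> 0 then sgn (sum h S) else sgn (sum g S))"
    using perturbation[OF I] by blast
  let ?x = "h + fscale e g"
  have h0: "h i = 0" if "i \<notin> B" for i
    by (rule generic_part_restrict_eq_0[OF h(1) that])
  have g0: "g i = 0" if "i \<in> B \<or> i \<notin> I" for i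
    by (rule generic_part_restrict_eq_0[OF g(1)]) (use that in blast)
  have sum_h: "sum h S = sum h (S \<inter> B)" and sum_g: "sum g S = sum g (S - B)" if "S \<subseteq> I" for S
    using finite_subset[OF that I] h0 g0 by (auto intro!: sum.mono_neutral_right)
  have sum0: "sum h S = 0 \<and> sum g S = 0" if "S \<subseteq> I" "sum ?x S = 0" for S
    using sg[rule_format, OF that(1)] that(2) by (auto simp: sgn_zero_iff split: if_splits)
  have "generic I Q ?x"
    unfolding generic_def
  proof (intro conjI allI impI)
    have "sum ?x K = 0" if K: "K \<in> Q" for K
    proof -
      have KI: "K \<subseteq> I" by (rule partition_on_block(1)[OF Q K])
      have "sum h K = 0"
      proof (cases "K \<subseteq> B")
        case True
        then show ?thesis using h(1) K unfolding generic_def Tv_def part_restrict_def by blast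
      next
        case False
        then have "K \<inter> B = {}" using B(1) K by blast
        then show ?thesis using sum_h[OF KI] by simp
      qed
      moreover have "sum g K = 0"
      proof (cases "K \<subseteq> B")
        case True
        then show ?thesis using g0 by (intro sum.neutral) blast
      next
        case False
        then have "K \<subseteq> I - B" using B(1) K KI by blast
        then show ?thesis using g(1) K unfolding generic_def Tv_def part_restrict_def by blast
      qed
      ultimately show ?thesis
        using sg[rule_format, OF KI] by (simp add: sgn_zero_iff)
    qed
    moreover have "?x i = 0" if "i \<notin> I" for i
      using h0[of i] g0[of i] that B(2) by (auto simp: fscale_def)
    ultimately show "?x \<in> Tv I Q" unfolding Tv_def by blast
  next
    fix S assume S: "S \<subseteq> I" "sum ?x S = 0"
    have "saturated (part_restrict I Q B) S" "saturated (part_restrict I Q (I - B)) S"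
      using sum0[OF S] h(1) g(1) S(1) unfolding generic_def by blast+
    moreover have "K \<in> part_restrict I Q B \<or> K \<in> part_restrict I Q (I - B)" if "K \<in> Q" for K
      using that B(1) partition_on_block(1)[OF Q that] unfolding part_restrict_def by blast
    ultimately show "saturated Q S" by blast
  qed
  then have X: "face_of I ?x \<in> faces I Q" and xI: "?x \<in> Tv I {I}"
    using mem_faces_iff[OF I Q] generic_imp_Tv[OF I Q] by blast+
  have "face_of I (point_restrict B ?x) = face_of I h"
  proof (rule face_of_cong)
    fix S assume S: "S \<subseteq> I"
    have "sgn (sum ?x (S \<inter> B)) = (if sum h (S \<inter> B) \<noteq> 0 then sgn (sum h (S \<inter> B)) else sgn (sum g (S \<inter> B)))"
      using sg S by blast
    moreover have "sum g (S \<inter> B) = 0"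
      using g0 by (intro sum.neutral) blast
    ultimately show "sgn (sum (point_restrict B ?x) S) = sgn (sum h S)"
      using sum_h[OF S] sum_point_restrict[OF finite_subset[OF S I]] by simp
  qed
  moreover have "face_of I (point_restrict (I - B) ?x) = face_of I g"
  proof (rule face_of_cong)
    fix S assume S: "S \<subseteq> I"
    have SB: "S \<inter> (I - B) = S - B" using S by blast
    have "S - B \<subseteq> I" using S by blast
    then have "sgn (sum ?x (S - B)) = (if sum h (S - B) \<noteq> 0 then sgn (sum h (S - B)) else sgn (sum g (S - B)))"
      using sg by blast
    moreover have "sum h (S - B) = 0"
      using h0 by (intro sum.neutral) blast
    ultimately show "sgn (sum (point_restrict (I - B) ?x) S) = sgn (sum g S)"
      using sum_g[OF S] sum_point_restrict[OF finite_subset[OF S I]] SB by simp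
  qed
  ultimately show ?thesis
    using X face_restrict_face_of[OF I B(2) xI] face_restrict_face_of[OF I B'(2) xI] h(2) g(2) by blast
qed

section \<open>Cuts of partitions and of faces\<close>

lemma redn_eq_empty_iff:
  assumes "partition_on I Q" "S \<subseteq> I"
  shows "redn Q S = {} \<longleftrightarrow> saturated Q S"
proof
  assume *: "redn Q S = {}"
  show "saturated Q S"
  proof (intro ballI disjCI)
    fix B assume B: "B \<in> Q" "B \<inter> S \<noteq> {}"
    then obtain i K where K: "i \<in> B" "K \<in> Q" "K \<subseteq> S" "i \<in> K"
      using * unfolding redn_def by blast
    then show "B \<subseteq> S"
      using partition_on_eqI[OF assms(1) B(1) K(2)] by blast
  qed
next
  assume *: "saturated Q S"
  have "\<exists>K\<in>Q. K \<subseteq> S \<and> i \<in> K" if i: "i \<in> S" for i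
  proof -
    obtain K where "K \<in> Q" "i \<in> K"
      using partition_on_obtain[OF assms(1)] i assms(2) by blast
    then show ?thesis using * i by blast
  qed
  then show "redn Q S = {}" unfolding redn_def by blast
qed

lemma cut_target_swap: "cut_target Q (D, C) = cut_target Q (C, D)"
  by (simp add: cut_target_def Un_commute insert_commute)

lemma is_cut_swap: "is_cut Q (D, C) \<longleftrightarrow> is_cut Q (C, D)"
  by (auto simp: is_cut_def Un_commute)

lemma is_cutD:
  assumes "is_cut Q (C, D)"
  shows "C \<noteq> {}" "D \<noteq> {}" "C \<inter> D = {}" "C \<union> D \<in> Q"
  using assms by (simp_all add: is_cut_def)

lemma partition_on_cut_target:
  assumes Q: "partition_on I Q" and v: "is_cut Q (C, D)"
  shows "partition_on I (cut_target Q (C, D))"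
proof (rule partition_onI)
  note v = is_cutD[OF v]
  show "\<Union>(cut_target Q (C, D)) = I"
    using partition_onD1[OF Q] v(4) unfolding cut_target_def by auto
  show "{} \<notin> cut_target Q (C, D)"
    using partition_on_block(2)[OF Q] v(1,2) unfolding cut_target_def by auto
  show "disjnt K L" if KL: "K \<in> cut_target Q (C, D)" "L \<in> cut_target Q (C, D)" "K \<noteq> L" for K L
  proof -
    have old: "M \<inter> (C \<union> D) = {}" if "M \<in> Q" "M \<noteq> C \<union> D" for M
      using partition_on_eqI[OF Q that(1) v(4)] that(2) by blast
    consider "K \<in> Q" "L \<in> Q" | "K \<in> {C, D}" "L \<in> {C, D}"
      | "K \<in> {C, D}" "L \<in> Q" "L \<noteq> C \<union> D" | "L \<in> {C, D}" "K \<in> Q" "K \<noteq> C \<union> D"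
      using KL(1,2) unfolding cut_target_def by auto
    then show ?thesis
    proof cases
      case 1
      then show ?thesis using partition_on_eqI[OF Q 1] KL(3) by (auto simp: disjnt_def)
    next
      case 2
      then show ?thesis using v(3) KL(3) by (auto simp: disjnt_def)
    next
      case 3
      then show ?thesis using old[of L] by (auto simp: disjnt_def)
    next
      case 4
      then show ?thesis using old[of K] by (auto simp: disjnt_def)
    qed
  qed
qed

lemma saturated_cut_target:
  assumes "is_cut Q (C, D)"
  shows "saturated (cut_target Q (C, D)) S \<longleftrightarrow>
    (\<forall>B\<in>Q - {C \<union> D}. B \<subseteq> S \<or> B \<inter> S = {}) \<and> (C \<subseteq> S \<or> C \<inter> S = {}) \<and> (D \<subseteq> S \<or> D \<inter> S = {})"
  unfolding cut_target_def by auto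

lemma saturated_imp_saturated_cut_target:
  assumes "is_cut Q (C, D)" "saturated Q S"
  shows "saturated (cut_target Q (C, D)) S" "C \<subseteq> S \<longleftrightarrow> D \<subseteq> S"
proof -
  note v = is_cutD[OF assms(1)]
  have CD: "C \<union> D \<subseteq> S \<or> (C \<union> D) \<inter> S = {}" using bspec[OF assms(2) v(4)] .
  have "\<forall>B\<in>Q - {C \<union> D}. B \<subseteq> S \<or> B \<inter> S = {}"
    using assms(2) by simp
  moreover have "C \<subseteq> S \<or> C \<inter> S = {}" "D \<subseteq> S \<or> D \<inter> S = {}"
    using CD by blast+
  ultimately show "saturated (cut_target Q (C, D)) S"
    unfolding saturated_cut_target[OF assms(1)] by (intro conjI)
  show "C \<subseteq> S \<longleftrightarrow> D \<subseteq> S"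
    using CD v(1,2) by blast
qed

lemma saturated_if_saturated_cut_target:
  assumes "is_cut Q (C, D)" "saturated (cut_target Q (C, D)) S" "C \<subseteq> S \<longleftrightarrow> D \<subseteq> S"
  shows "saturated Q S"
proof (intro ballI)
  fix B assume B: "B \<in> Q"
  note sat = assms(2)[unfolded saturated_cut_target[OF assms(1)]]
  show "B \<subseteq> S \<or> B \<inter> S = {}"
  proof (cases "B = C \<union> D")
    case True
    then show ?thesis using sat[THEN conjunct2] assms(3) is_cutD(1,2)[OF assms(1)] by blast
  next
    case False
    then show ?thesis using bspec[OF sat[THEN conjunct1], of B] B by simp
  qed
qed

text \<open>No block of \<open>Q\<close> fits into \<open>C\<close>, a proper part of the block
  \<open>C \<union> D\<close>, so \<open>redn Q C\<close> is \<open>C\<close> itself. Equality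
  modulo \<open>Q\<close> then says that \<open>S\<close> consists of \<open>C\<close> and of
  further blocks of \<open>Q\<close>, a condition that can be read off from the sums of a generic
  point.\<close>

lemma redn_eq_left_iff:
  assumes Q: "partition_on I Q" and v: "is_cut Q (C, D)" and S: "S \<subseteq> I"
  shows "redn Q S = redn Q C \<longleftrightarrow> C \<subseteq> S \<and> D \<inter> S = {} \<and> saturated (cut_target Q (C, D)) S"
proof -
  note v' = is_cutD[OF v]
  have meet: "K = C \<union> D" if "K \<in> Q" "K \<inter> (C \<union> D) \<noteq> {}" for K
    by (rule partition_on_eqI[OF Q that(1) v'(4) that(2)])
  have "\<not> K \<subseteq> C" if "K \<in> Q" for K
    using meet[OF that] partition_on_block(2)[OF Q that] v'(2,3) by blast
  then have C: "redn Q C = C" unfolding redn_def by blast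
  show ?thesis unfolding C
  proof
    assume *: "redn Q S = C"
    then have CS: "C \<subseteq> S" unfolding redn_def by blast
    have "\<not> C \<union> D \<subseteq> S"
      using * v'(1,4) unfolding redn_def by blast
    have block: "\<exists>K\<in>Q. K \<subseteq> S \<and> i \<in> K" if "i \<in> S" "i \<notin> C" for i
      using * that unfolding redn_def by blast
    have "D \<inter> S = {}"
    proof (rule ccontr)
      assume "D \<inter> S \<noteq> {}"
      then obtain i where i: "i \<in> D" "i \<in> S" by blast
      with block[of i] v'(3) obtain K where "K \<in> Q" "K \<subseteq> S" "i \<in> K" by blast
      then show False using meet[of K] i \<open>\<not> C \<union> D \<subseteq> S\<close> by blast
    qed
    moreover have "B \<subseteq> S \<or> B \<inter> S = {}" if B: "B \<in> Q - {C \<union> D}" for B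
    proof (rule disjCI)
      assume "B \<inter> S \<noteq> {}"
      then obtain i where i: "i \<in> B" "i \<in> S" by blast
      moreover have "i \<notin> C" using meet[of B] B i by blast
      ultimately obtain K where K: "K \<in> Q" "K \<subseteq> S" "i \<in> K" using block by blast
      then show "B \<subseteq> S" using partition_on_eqI[OF Q, of B K] B i by blast
    qed
    ultimately show "C \<subseteq> S \<and> D \<inter> S = {} \<and> saturated (cut_target Q (C, D)) S"
      unfolding saturated_cut_target[OF v] using CS by blast
  next
    assume *: "C \<subseteq> S \<and> D \<inter> S = {} \<and> saturated (cut_target Q (C, D)) S"
    then have sat: "\<forall>B\<in>Q - {C \<union> D}. B \<subseteq> S \<or> B \<inter> S = {}"
      unfolding saturated_cut_target[OF v] by blast
    have "\<exists>K\<in>Q. K \<subseteq> S \<and> i \<in> K" if i: "i \<in> S" "i \<notin> C" for i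
    proof -
      obtain K where K: "K \<in> Q" "i \<in> K"
        using partition_on_obtain[OF Q] i S by blast
      have "K \<noteq> C \<union> D" using * i K by blast
      then show ?thesis using sat K i by blast
    qed
    then have "redn Q S \<subseteq> C" unfolding redn_def by blast
    moreover have "i \<notin> K" if i: "i \<in> C" and K: "K \<in> Q" "K \<subseteq> S" for i K
    proof
      assume "i \<in> K"
      then have "K = C \<union> D" using meet[OF K(1)] i by blast
      then show False using K(2) * v'(2) by blast
    qed
    then have "C \<subseteq> redn Q S" using * unfolding redn_def by blast
    ultimately show "redn Q S = C" by (rule subset_antisym)
  qed
qed

text \<open>The sign at \<open>S\<close> of \<open>h\<close> pushed slightly along the difference of
  the unit vectors at some \<open>c\<close> in \<open>C\<close> and some \<open>d\<close> in
  \<open>D\<close>. If \<open>h\<close> is generic for the cut partition and sums to 0 over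
  \<open>S\<close>, then \<open>S\<close> contains or misses each of \<open>C\<close> and
  \<open>D\<close>; hence the choice of \<open>c\<close> and \<open>d\<close> is immaterial, and one
  formula covers all the cases of \<open>face_cut\<close>.\<close>

definition cut_sign :: "'a set \<Rightarrow> 'a set \<Rightarrow> ('a \<Rightarrow> real) \<Rightarrow> 'a set \<Rightarrow> real"
  where "cut_sign C D h S =
    (if sum h S \<noteq> 0 then sgn (sum h S) else of_bool (C \<subseteq> S) - of_bool (D \<subseteq> S))"

lemma face_cut_face_of:
  assumes I: "finite I" and Q: "partition_on I Q" and v: "is_cut Q (C, D)"
    and h: "generic I (cut_target Q (C, D)) h"
  shows "face_cut I Q (C, D) (face_of I h) = face_of_sign I (cut_sign C D h)"
  unfolding face_cut_def prod.case
proof (rule face_of_sign_cong)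
  fix S assume "S \<noteq> {}" "S \<subset> I"
  then have S: "S \<subseteq> I" by blast
  note v' = is_cutD[OF v]
  note Q' = partition_on_cut_target[OF Q v]
  have zero: "sum h S = 0 \<longleftrightarrow> saturated (cut_target Q (C, D)) S"
    by (rule generic_sum_eq_0_iff[OF I Q' h S])
  have C: "redn Q S = redn Q C \<longleftrightarrow> C \<subseteq> S \<and> D \<inter> S = {} \<and> sum h S = 0"
    unfolding zero by (rule redn_eq_left_iff[OF Q v S])
  have D: "redn Q S = redn Q D \<longleftrightarrow> D \<subseteq> S \<and> C \<inter> S = {} \<and> sum h S = 0"
    using redn_eq_left_iff[OF Q, of D C S] v S unfolding zero by (simp only: is_cut_swap cut_target_swap)
  have sign: "face_sign (face_of I h) S = sgn (sum h S)"
    by (rule face_sign_face_of[OF generic_imp_Tv[OF I Q' h] S])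
  show "(if redn Q S = redn Q C then 1 else if redn Q S = redn Q D then - 1
      else if redn (cut_target Q (C, D)) S \<noteq> {} then face_sign (face_of I h) S else 0) = cut_sign C D h S"
  proof (cases "sum h S = 0")
    case False
    then show ?thesis
      unfolding C D sign redn_eq_empty_iff[OF Q' S] zero[symmetric] by (simp add: cut_sign_def)
  next
    case True
    then have "C \<subseteq> S \<or> C \<inter> S = {}" "D \<subseteq> S \<or> D \<inter> S = {}"
      unfolding zero saturated_cut_target[OF v] by blast+
    moreover have "\<not> (C \<subseteq> S \<and> C \<inter> S = {})" "\<not> (D \<subseteq> S \<and> D \<inter> S = {})"
      using v'(1,2) by blast+
    ultimately show ?thesis
      unfolding C D sign redn_eq_empty_iff[OF Q' S] zero[symmetric]
      using True by (auto simp: cut_sign_def)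
  qed
qed

text \<open>This makes the cut of a face nonempty with the right support. The push destroys exactly
  those vanishing sums whose \<open>S\<close> separates \<open>C\<close> from \<open>D\<close>; the
  remaining ones belong to unions of blocks of \<open>Q\<close>.\<close>

lemma generic_cut:
  assumes I: "finite I" and Q: "partition_on I Q" and v: "is_cut Q (C, D)"
    and h: "generic I (cut_target Q (C, D)) h"
  obtains h' where "generic I Q h'" "\<And>S. S \<subseteq> I \<Longrightarrow> sgn (sum h' S) = cut_sign C D h S"
proof -
  note v' = is_cutD[OF v]
  note Q' = partition_on_cut_target[OF Q v]
  obtain c d where c: "c \<in> C" and d: "d \<in> D" using v'(1,2) by blast
  have cdI: "c \<in> I" "d \<in> I" using partition_on_block(1)[OF Q v'(4)] c d by blast+
  define g :: "'a \<Rightarrow> real" where "g = (\<lambda>i. (if i = c then 1 else 0) - (if i = d then 1 else 0))"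
  have sum_g: "sum g S = of_bool (c \<in> S) - of_bool (d \<in> S)" if "S \<subseteq> I" for S
    using finite_subset[OF that I] by (simp add: g_def sum_subtractf)
  obtain e where sg: "\<forall>S\<subseteq>I. sgn (sum (h + fscale e g) S)
      = (if sum h S \<noteq> 0 then sgn (sum h S) else sgn (sum g S))"
    using perturbation[OF I] by blast
  let ?x = "h + fscale e g"
  have zero: "sum h S = 0 \<longleftrightarrow> saturated (cut_target Q (C, D)) S" if "S \<subseteq> I" for S
    by (rule generic_sum_eq_0_iff[OF I Q' h that])
  have sign: "sgn (sum ?x S) = cut_sign C D h S" if S: "S \<subseteq> I" for S
  proof (cases "sum h S = 0")
    case True
    then have "c \<in> S \<longleftrightarrow> C \<subseteq> S" "d \<in> S \<longleftrightarrow> D \<subseteq> S"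
      using c d unfolding zero[OF S] saturated_cut_target[OF v] by blast+
    then show ?thesis
      using sg S True sum_g[OF S] by (simp add: cut_sign_def)
  qed (use sg S in \<open>simp add: cut_sign_def\<close>)
  have "generic I Q ?x"
    unfolding generic_def
  proof (intro conjI allI impI)
    have "sum ?x K = 0" if K: "K \<in> Q" for K
    proof -
      note KI = partition_on_block(1)[OF Q K]
      note sat = saturated_imp_saturated_cut_target[OF v saturated_block[OF Q K]]
      have "sum h K = 0" unfolding zero[OF KI] by (rule sat(1))
      then have "sgn (sum ?x K) = 0"
        using sat(2) unfolding sign[OF KI] by (simp add: cut_sign_def)
      then show ?thesis by (simp add: sgn_zero_iff)
    qed
    moreover have "?x i = 0" if "i \<notin> I" for i
      using that cdI h by (auto simp: fscale_def g_def generic_def Tv_def)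
    ultimately show "?x \<in> Tv I Q" unfolding Tv_def by blast
  next
    fix S assume S: "S \<subseteq> I" "sum ?x S = 0"
    then have sign0: "cut_sign C D h S = 0" using sign[OF S(1)] by simp
    then have h0: "sum h S = 0" by (auto simp: cut_sign_def sgn_zero_iff split: if_splits)
    with sign0 have "C \<subseteq> S \<longleftrightarrow> D \<subseteq> S" by (auto simp: cut_sign_def of_bool_def split: if_splits)
    then show "saturated Q S"
      using saturated_if_saturated_cut_target[OF v] h0 unfolding zero[OF S(1)] by blast
  qed
  then show ?thesis using sign by (rule that)
qed

lemma face_cut_point:
  assumes I: "finite I" and Q: "partition_on I Q" and v: "is_cut Q (C, D)"
    and X: "X \<in> faces I (cut_target Q (C, D))"
  obtains h h' where "generic I (cut_target Q (C, D)) h" "X = face_of I h" "generic I Q h'"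
    "face_cut I Q (C, D) X = face_of I h'" "\<And>S. S \<subseteq> I \<Longrightarrow> sgn (sum h' S) = cut_sign C D h S"
proof -
  obtain h where h: "generic I (cut_target Q (C, D)) h" "X = face_of I h"
    using X mem_faces_iff[OF I partition_on_cut_target[OF Q v]] by blast
  obtain h' where h': "generic I Q h'" "\<And>S. S \<subseteq> I \<Longrightarrow> sgn (sum h' S) = cut_sign C D h S"
    using generic_cut[OF I Q v h(1)] by blast
  have "face_cut I Q (C, D) X = face_of I h'"
    unfolding h(2) face_cut_face_of[OF I Q v h(1)] face_of_def[of I h']
    by (rule face_of_sign_cong) (simp add: h'(2))
  then show ?thesis using that h h' by blast
qed

lemma face_cut_in_faces:
  assumes I: "finite I" and Q: "partition_on I Q" and v: "is_cut Q (C, D)"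
    and X: "X \<in> faces I (cut_target Q (C, D))"
  shows "face_cut I Q (C, D) X \<in> faces I Q"
  using face_cut_point[OF assms] mem_faces_iff[OF I Q] by metis

section \<open>Interaction of cuts with restrictions\<close>

lemma is_cut_part_restrict:
  assumes "is_cut Q (C, D)" "C \<union> D \<subseteq> B"
  shows "is_cut (part_restrict I Q B) (C, D)"
  using assms by (simp add: is_cut_def part_restrict_def)

text \<open>The parts of a cut are nonempty and disjoint, so the singletons outside \<open>B\<close>
  cannot be cut.\<close>

lemma is_cut_part_restrictD:
  assumes "is_cut (part_restrict I Q B) (C, D)"
  shows "is_cut Q (C, D)" "C \<union> D \<subseteq> B"
proof -
  note v = is_cutD[OF assms]
  obtain c d where "c \<in> C" "d \<in> D" "c \<noteq> d"
    using v(1-3) by blast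
  then have "C \<union> D \<noteq> {i}" for i
    by (metis UnI1 UnI2 singletonD)
  then have "C \<union> D \<in> {K \<in> Q. K \<subseteq> B}"
    using v(4) unfolding part_restrict_def by blast
  then show "is_cut Q (C, D)" "C \<union> D \<subseteq> B"
    using v by (simp_all add: is_cut_def)
qed

lemma cut_target_part_restrict:
  assumes v: "is_cut Q (C, D)" and CD: "C \<union> D \<subseteq> B"
  shows "cut_target (part_restrict I Q B) (C, D) = part_restrict I (cut_target Q (C, D)) B"
proof -
  have "C \<union> D \<notin> (\<lambda>i. {i}) ` (I - B)"
    using is_cutD(1)[OF v] CD by blast
  then have "part_restrict I Q B - {C \<union> D} = {K \<in> Q - {C \<union> D}. K \<subseteq> B} \<union> (\<lambda>i. {i}) ` (I - B)"
    unfolding part_restrict_def by auto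
  then show ?thesis
    using CD unfolding cut_target_def part_restrict_def by auto
qed

lemma part_restrict_cut_target_disjoint:
  assumes v: "is_cut Q (C, D)" and CD: "(C \<union> D) \<inter> B = {}"
  shows "part_restrict I (cut_target Q (C, D)) B = part_restrict I Q B"
proof -
  have "\<not> C \<subseteq> B" "\<not> D \<subseteq> B" "\<not> C \<union> D \<subseteq> B"
    using CD is_cutD(1,2)[OF v] by blast+
  then have "{K \<in> cut_target Q (C, D). K \<subseteq> B} = {K \<in> Q. K \<subseteq> B}"
    unfolding cut_target_def by auto
  then show ?thesis by (simp add: part_restrict_def)
qed

text \<open>Only sums over \<open>S \<inter> B\<close> matter, and such a set contains neither
  \<open>C\<close> nor \<open>D\<close>, so the second term of \<open>cut_sign\<close> is 0.\<close>

lemma face_restrict_face_cut_disjoint: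
  assumes I: "finite I" and Q: "partition_on I Q" and v: "is_cut Q (C, D)"
    and X: "X \<in> faces I (cut_target Q (C, D))" and B: "B \<subseteq> I" "(C \<union> D) \<inter> B = {}"
  shows "face_restrict I B (face_cut I Q (C, D) X) = face_restrict I B X"
proof -
  obtain h h' where h: "generic I (cut_target Q (C, D)) h" "X = face_of I h" "generic I Q h'"
    "face_cut I Q (C, D) X = face_of I h'" "\<And>S. S \<subseteq> I \<Longrightarrow> sgn (sum h' S) = cut_sign C D h S"
    using face_cut_point[OF I Q v X] by blast
  have "h \<in> Tv I {I}" "h' \<in> Tv I {I}"
    using generic_imp_Tv[OF I] partition_on_cut_target[OF Q v] Q h by blast+
  moreover have "face_of I (point_restrict B h') = face_of I (point_restrict B h)"
  proof (rule face_of_cong)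
    fix S assume S: "S \<subseteq> I"
    have "\<not> C \<subseteq> S \<inter> B" "\<not> D \<subseteq> S \<inter> B"
      using B(2) is_cutD(1,2)[OF v] by blast+
    then have "sgn (sum h' (S \<inter> B)) = sgn (sum h (S \<inter> B))"
      using h(5)[of "S \<inter> B"] S by (auto simp: cut_sign_def le_infI1)
    then show "sgn (sum (point_restrict B h') S) = sgn (sum (point_restrict B h) S)"
      by (simp add: sum_point_restrict finite_subset[OF S I])
  qed
  ultimately show ?thesis
    unfolding h(4) unfolding h(2) by (simp add: face_restrict_face_of[OF I B(1)])
qed

text \<open>As \<open>C\<close> and \<open>D\<close> lie in \<open>B\<close>, the sets
  \<open>S\<close> and \<open>S \<inter> B\<close> contain the same ones of them, so
  \<open>cut_sign\<close> comes out the same before and after restricting.\<close>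

lemma face_restrict_face_cut:
  assumes I: "finite I" and Q: "partition_on I Q" and v: "is_cut Q (C, D)"
    and X: "X \<in> faces I (cut_target Q (C, D))"
    and B: "saturated Q B" "B \<subseteq> I" "C \<union> D \<subseteq> B"
  shows "face_restrict I B (face_cut I Q (C, D) X)
    = face_cut I (part_restrict I Q B) (C, D) (face_restrict I B X)"
proof -
  obtain h h' where h: "generic I (cut_target Q (C, D)) h" "X = face_of I h" "generic I Q h'"
    "face_cut I Q (C, D) X = face_of I h'" "\<And>S. S \<subseteq> I \<Longrightarrow> sgn (sum h' S) = cut_sign C D h S"
    using face_cut_point[OF I Q v X] by blast
  have Tv: "h \<in> Tv I {I}" "h' \<in> Tv I {I}"
    using generic_imp_Tv[OF I] partition_on_cut_target[OF Q v] Q h by blast+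
  have gen: "generic I (cut_target (part_restrict I Q B) (C, D)) (point_restrict B h)"
    unfolding cut_target_part_restrict[OF v B(3)] by (rule generic_point_restrict[OF I B(2) h(1)])
  have "face_of I (point_restrict B h') = face_of_sign I (cut_sign C D (point_restrict B h))"
    unfolding face_of_def
  proof (rule face_of_sign_cong)
    fix S assume "S \<subset> I"
    then have S: "S \<subseteq> I" by blast
    have "C \<subseteq> S \<inter> B \<longleftrightarrow> C \<subseteq> S" "D \<subseteq> S \<inter> B \<longleftrightarrow> D \<subseteq> S"
      using B(3) by blast+
    then show "sgn (sum (point_restrict B h') S) = cut_sign C D (point_restrict B h) S"
      using h(5)[of "S \<inter> B"] S
      by (simp add: cut_sign_def le_infI1 sum_point_restrict finite_subset[OF S I])
  qed
  also have "\<dots> = face_cut I (part_restrict I Q B) (C, D) (face_of I (point_restrict B h))"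
    by (rule face_cut_face_of[OF I partition_on_part_restrict[OF Q B(1,2)]
        is_cut_part_restrict[OF v B(3)] gen, symmetric])
  finally show ?thesis
    unfolding h(4) unfolding h(2) face_restrict_face_of[OF I B(2) Tv(1)] face_restrict_face_of[OF I B(2) Tv(2)] .
qed

text \<open>Induction over the set \<open>J\<close> of blocks already glued, with singletons
  elsewhere. It starts from the zero face, since \<open>Tv\<close> of the partition into singletons
  is \<open>{0}\<close>.\<close>

lemma faces_glue_all:
  assumes I: "finite I" and P: "partition_on I P"
    and y: "\<And>B. B \<in> P \<Longrightarrow> y B \<in> faces I (single_block I B)"
  shows "\<exists>X\<in>faces I P. \<forall>B\<in>P. face_restrict I B X = y B"
proof -
  have "\<exists>X\<in>faces I (J \<union> (\<lambda>i. {i}) ` (I - \<Union>J)). \<forall>B\<in>J. face_restrict I B X = y B"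
    if "J \<subseteq> P" for J
    using finite_subset[OF that finite_elements[OF I P]] that
  proof (induction J rule: finite_induct)
    case empty
    have "partition_on I ((\<lambda>i. {i}) ` I)"
      by (rule partition_onI) (auto simp: disjnt_def)
    moreover have "generic I ((\<lambda>i. {i}) ` I) (\<lambda>_. 0)"
      by (simp add: generic_def Tv_def)
    ultimately have "face_of I (\<lambda>_. 0) \<in> faces I ((\<lambda>i. {i}) ` I)"
      using mem_faces_iff[OF I] by blast
    then show ?case by auto
  next
    case (insert B J)
    let ?R = "\<lambda>J. J \<union> (\<lambda>i. {i}) ` (I - \<Union>J)"
    have B: "B \<in> P" and J: "J \<subseteq> P" using insert.prems by auto
    obtain X where X: "X \<in> faces I (?R J)" "\<And>B'. B' \<in> J \<Longrightarrow> face_restrict I B' X = y B'"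
      using insert.IH[OF J] by blast
    let ?Q = "?R (insert B J)"
    have Q: "partition_on I ?Q"
    proof (rule partition_onI)
      show "\<Union>?Q = I"
        using partition_on_block(1)[OF P] insert.prems by auto
      show "{} \<notin> ?Q"
        using partition_on_block(2)[OF P] insert.prems by auto
      show "disjnt K L" if KL: "K \<in> ?Q" "L \<in> ?Q" "K \<noteq> L" for K L
      proof (cases "K \<in> insert B J \<and> L \<in> insert B J")
        case True
        then have "K \<in> P" "L \<in> P" using insert.prems by blast+
        then show ?thesis using partition_on_eqI[OF P] KL(3) unfolding disjnt_def by blast
      next
        case False
        then show ?thesis using KL unfolding disjnt_def by auto
      qed
    qed
    have BQ: "B \<in> ?Q" and BI: "B \<subseteq> I" using partition_on_block(1)[OF P B] by auto
    have disj: "K \<inter> B = {}" if "K \<in> J" for K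
      using partition_on_eqI[OF P _ B] that J insert.hyps(2) by blast
    \<comment> \<open>Restricting to \<open>I - B\<close> turns the points of \<open>B\<close> back
      into singletons, so the face built so far is the complementary piece that
      \<open>faces_glue\<close> asks for.\<close>
    have "part_restrict I ?Q (I - B) = ?R J"
    proof
      show "part_restrict I ?Q (I - B) \<subseteq> ?R J"
      proof
        fix K assume "K \<in> part_restrict I ?Q (I - B)"
        then consider "K \<in> ?Q" "K \<subseteq> I - B" | i where "K = {i}" "i \<in> B"
          unfolding part_restrict_def by auto
        then show "K \<in> ?R J"
        proof cases
          case 1
          then show ?thesis using partition_on_block(2)[OF P B] by auto
        next
          case 2
          then have "i \<in> I - \<Union>J" using disj BI by blast
          then show ?thesis using 2 by blast
        qed
      qed
      show "?R J \<subseteq> part_restrict I ?Q (I - B)"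
      proof
        fix K assume "K \<in> ?R J"
        then consider "K \<in> J" | i where "K = {i}" "i \<in> I - \<Union>J" by blast
        then show "K \<in> part_restrict I ?Q (I - B)"
        proof cases
          case 1
          then have "K \<subseteq> I - B"
            using disj[OF 1] partition_on_block(1)[OF P] J by blast
          then show ?thesis using 1 unfolding part_restrict_def by blast
        next
          case 2
          then show ?thesis unfolding part_restrict_def by (cases "i \<in> B") auto
        qed
      qed
    qed
    with X(1) have "X \<in> faces I (part_restrict I ?Q (I - B))" by (simp only:)
    moreover have "y B \<in> faces I (part_restrict I ?Q B)"
      using y[OF B] unfolding part_restrict_block[OF Q BQ] .
    ultimately obtain X' where X': "X' \<in> faces I ?Q" "face_restrict I B X' = y B"
      "face_restrict I (I - B) X' = X"
      using faces_glue[OF I Q saturated_block[OF Q BQ] BI] by blast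
    have "face_restrict I B' X' = y B'" if B': "B' \<in> J" for B'
    proof -
      have "saturated ?Q (I - B)"
        using saturated_block[OF Q BQ] partition_on_block(1)[OF Q] by blast
      moreover have "B' \<subseteq> I" "B' \<inter> (I - B) = B'"
        using disj[OF B'] partition_on_block(1)[OF P] J B' by blast+
      ultimately have "face_restrict I B' X' = face_restrict I B' X"
        using face_restrict_face_restrict[OF I Q _ Diff_subset X'(1), of B B'] X'(3) by simp
      then show ?thesis using X(2)[OF B'] by simp
    qed
    then show ?case using X' by blast
  qed
  from this[OF subset_refl] show ?thesis
    using partition_onD1[OF P] by simp
qed


section \<open>Semisimple functionals\<close>

lemma semisimple_cong:
  assumes P: "finite P" and f: "semisimple I P f" and X: "X \<in> faces I P" "X' \<in> faces I P"
    and eq: "\<And>B. B \<in> P \<Longrightarrow> face_restrict I B X = face_restrict I B X'"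
  shows "f X = f X'"
proof -
  obtain x where x: "f = prod_free I P x"
    using f unfolding semisimple_def ext_prod_image[OF P] by blast
  have "prod_pure I P t X = prod_pure I P t X'" for t :: "'a set \<Rightarrow> ('a \<Rightarrow> real) set \<Rightarrow> 'b"
    using X by (auto simp: prod_pure_def eq intro!: prod.cong)
  then show ?thesis
    by (simp add: x prod_free_def sum_fun_apply fscale_def)
qed

lemma semisimpleI:
  fixes f :: "('a \<Rightarrow> real) set \<Rightarrow> 'k::field"
  assumes I: "finite I" and P: "partition_on I P" and f: "f \<in> functionals I P"
    and cong: "\<And>X X'. X \<in> faces I P \<Longrightarrow> X' \<in> faces I P \<Longrightarrow>
      (\<And>B. B \<in> P \<Longrightarrow> face_restrict I B X = face_restrict I B X') \<Longrightarrow> f X = f X'"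
  shows "semisimple I P f"
proof -
  let ?\<Omega> = "\<lambda>B. faces I (single_block I B)"
  \<comment> \<open>Which face is chosen is immaterial by \<open>cong\<close>. A tuple without such
    a face gets an arbitrary value; this is harmless, as any slice cut off outside the faces is a
    functional.\<close>
  define \<Phi> where "\<Phi> y = f (SOME X. X \<in> faces I P \<and> (\<forall>B\<in>P. face_restrict I B X = y B))" for y
  have "f \<in> prod_free I P ` free_space P (\<lambda>B. functionals I (single_block I B))"
  proof (rule prod_free_surj[where \<Omega> = ?\<Omega> and \<Phi> = \<Phi>])
    show "finite P" by (rule finite_elements[OF I P])
    show "face_restrict I B X \<in> ?\<Omega> B" if "B \<in> P" "X \<in> faces I P" for B X
      using face_restrict_in_faces[OF I P saturated_block[OF P that(1)] partition_on_block(1)[OF P that(1)] that(2)]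
      by (simp add: part_restrict_block[OF P that(1)])
    show "f X = \<Phi> (\<lambda>B\<in>P. face_restrict I B X)" if X: "X \<in> faces I P" for X
    proof -
      let ?Y = "SOME Y. Y \<in> faces I P \<and> (\<forall>B\<in>P. face_restrict I B Y = (\<lambda>B\<in>P. face_restrict I B X) B)"
      have "?Y \<in> faces I P \<and> (\<forall>B\<in>P. face_restrict I B ?Y = (\<lambda>B\<in>P. face_restrict I B X) B)"
        by (rule someI[of _ X]) (use X in simp)
      then show ?thesis
        unfolding \<Phi>_def using X by (intro cong) auto
    qed
  qed (auto simp: functionals_subspace finite_faces[OF I] f, auto simp: functionals_def)
  then show ?thesis
    unfolding semisimple_def ext_prod_image[OF finite_elements[OF I P]] .
qed

section \<open>Semisimply differentiable functionals\<close>

lemma Gam_semisimple: "f \<in> Gam I P \<Longrightarrow> semisimple I P f"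
  unfolding Gam_def by (auto dest: spec[of _ "[]"])

text \<open>Putting \<open>v\<close> in front of a forest over the cut partition gives a forest over
  \<open>Q\<close>. Thus membership in \<open>Gam\<close>, unlike mere semisimplicity, passes
  through the inductions over forests.\<close>

lemma Gam_cut_deriv:
  assumes "f \<in> Gam I Q" "is_cut Q v"
  shows "cut_deriv I Q v f \<in> Gam I (cut_target Q v)"
proof -
  have "semisimple I (forest_target Q (v # F)) (forest_deriv I Q (v # F) f)"
    if "layered_forest (cut_target Q v) F" for F
    using assms that unfolding Gam_def by (metis (mono_tags, lifting) layered_forest.simps(2) mem_Collect_eq)
  moreover have "cut_deriv I Q v f \<in> functionals I (cut_target Q v)"
    by (auto simp: functionals_def cut_deriv_def split: prod.split)
  ultimately show ?thesis by (simp add: Gam_def)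
qed

lemma cut_deriv_apply:
  "X \<in> faces I (cut_target Q (C, D)) \<Longrightarrow>
    cut_deriv I Q (C, D) f X = f (face_cut I Q (C, D) X) - f (face_cut I Q (D, C) X)"
  by (simp add: cut_deriv_def)

text \<open>The generalization that makes the induction work: \<open>P\<close> stays fixed while
  \<open>Q\<close> is refined, so the factors live on unions of blocks of \<open>Q\<close>. The
  factor hit by a cut is replaced by its derivative, which is again in \<open>Gam\<close>.\<close>

lemma forest_deriv_prod_semisimple:
  fixes f :: "('a \<Rightarrow> real) set \<Rightarrow> 'k::field"
  assumes I: "finite I" and P: "partition_on I P"
    and "partition_on I Q" "\<And>B. B \<in> P \<Longrightarrow> saturated Q B" "f \<in> functionals I Q"
    and "\<And>B. B \<in> P \<Longrightarrow> t B \<in> Gam I (part_restrict I Q B)"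
    and "\<And>X. X \<in> faces I Q \<Longrightarrow> f X = (\<Prod>B\<in>P. t B (face_restrict I B X))"
    and "layered_forest Q F"
  shows "semisimple I (forest_target Q F) (forest_deriv I Q F f)"
  using assms(3-)
proof (induction F arbitrary: Q f t)
  case Nil
  note Q = Nil.prems(1) and sat = Nil.prems(2) and t = Nil.prems(4)
  have "semisimple I Q f"
  proof (rule semisimpleI[OF I Q Nil.prems(3)])
    fix X X' assume X: "X \<in> faces I Q" "X' \<in> faces I Q"
      and eq: "\<And>K. K \<in> Q \<Longrightarrow> face_restrict I K X = face_restrict I K X'"
    have "t B (face_restrict I B X) = t B (face_restrict I B X')" if B: "B \<in> P" for B
    proof -
      note BI = partition_on_block(1)[OF P B]
      let ?R = "part_restrict I Q B"
      have R: "partition_on I ?R"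
        by (rule partition_on_part_restrict[OF Q sat[OF B] BI])
      show ?thesis
      proof (rule semisimple_cong[OF finite_elements[OF I R] Gam_semisimple[OF t[OF B]]])
        show "face_restrict I B X \<in> faces I ?R" "face_restrict I B X' \<in> faces I ?R"
          using face_restrict_in_faces[OF I Q sat[OF B] BI] X by blast+
        fix K assume K: "K \<in> ?R"
        \<comment> \<open>Blocks of \<open>?R\<close> inside \<open>B\<close> are blocks of
          \<open>Q\<close>; a singleton outside \<open>B\<close> leads to the restriction to the
          empty set, which is the same for every face.\<close>
        have "face_restrict I (K \<inter> B) X = face_restrict I (K \<inter> B) X'"
        proof (cases "K \<in> Q \<and> K \<subseteq> B")
          case True
          then show ?thesis using eq[of K] by (simp add: Int_absorb2)
        next
          case False
          then have "K \<inter> B = {}" using K unfolding part_restrict_def by blast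
          then show ?thesis by (simp add: face_restrict_def)
        qed
        then show "face_restrict I K (face_restrict I B X) = face_restrict I K (face_restrict I B X')"
          using face_restrict_face_restrict[OF I Q sat[OF B] BI] X partition_on_block(1)[OF R K] by simp
      qed
    qed
    then show "f X = f X'"
      using Nil.prems(5) X by (simp cong: prod.cong)
  qed
  then show ?case by simp
next
  case (Cons v F)
  note Q = Cons.prems(1) and sat = Cons.prems(2) and t = Cons.prems(4) and f = Cons.prems(5)
  obtain C D where vCD: "v = (C, D)" by fastforce
  have v: "is_cut Q (C, D)" and v': "is_cut Q (D, C)" and F: "layered_forest (cut_target Q (C, D)) F"
    using Cons.prems(6) by (simp_all add: vCD is_cut_swap)
  note cut = is_cutD[OF v]
  let ?Q = "cut_target Q (C, D)"
  note Q' = partition_on_cut_target[OF Q v]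
  obtain i B0 where i: "i \<in> C" and B0: "B0 \<in> P" "i \<in> B0"
    using cut(1) partition_on_block(1)[OF Q cut(4)] partition_on_obtain[OF P]
    by (metis UnI1 ex_in_conv subsetD)
  have CD: "C \<union> D \<subseteq> B0" using bspec[OF sat[OF B0(1)] cut(4)] i B0(2) by blast
  note CD' = CD[unfolded Un_commute[of C]]
  have disj: "(C \<union> D) \<inter> B = {}" if "B \<in> P - {B0}" for B
    using partition_on_eqI[OF P B0(1), of B] CD that by blast
  let ?R = "part_restrict I Q B0"
  define t' where "t' = t(B0 := cut_deriv I ?R (C, D) (t B0))"
  have finP: "finite P" by (rule finite_elements[OF I P])
  have "semisimple I (forest_target ?Q F) (forest_deriv I ?Q F (cut_deriv I Q (C, D) f))"
  proof (rule Cons.IH[OF Q' _ _ _ _ F, of _ t'])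
    show "saturated ?Q B" if "B \<in> P" for B
      by (rule saturated_imp_saturated_cut_target(1)[OF v sat[OF that]])
    show "cut_deriv I Q (C, D) f \<in> functionals I ?Q"
      by (simp add: functionals_def cut_deriv_def)
    show "t' B \<in> Gam I (part_restrict I ?Q B)" if B: "B \<in> P" for B
    proof (cases "B = B0")
      case True
      then show ?thesis
        using Gam_cut_deriv[OF t[OF B] is_cut_part_restrict[OF v, of B I]] CD
          cut_target_part_restrict[OF v CD] by (simp add: t'_def)
    next
      case False
      then show ?thesis
        using t[OF B] part_restrict_cut_target_disjoint[OF v disj] B by (simp add: t'_def)
    qed
    fix X assume X: "X \<in> faces I ?Q"
    note X' = X[unfolded cut_target_swap[of Q C D]]
    note fc = face_cut_in_faces[OF I Q v X] face_cut_in_faces[OF I Q v' X']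
    \<comment> \<open>The factors away from \<open>B0\<close> take the same values at
      \<open>X\<close> and at both of its cuts, so they factor out of the difference.\<close>
    let ?rest = "\<Prod>B\<in>P - {B0}. t B (face_restrict I B X)"
    have rest: "(\<Prod>B\<in>P - {B0}. t B (face_restrict I B (face_cut I Q (C, D) X))) = ?rest"
      "(\<Prod>B\<in>P - {B0}. t B (face_restrict I B (face_cut I Q (D, C) X))) = ?rest"
      using face_restrict_face_cut_disjoint[OF I Q v X partition_on_block(1)[OF P] disj]
        face_restrict_face_cut_disjoint[OF I Q v' X' partition_on_block(1)[OF P] disj[unfolded Un_commute[of C]]]
      by (auto intro!: prod.cong)
    note BI = partition_on_block(1)[OF P B0(1)]
    have "face_restrict I B0 X \<in> faces I (cut_target ?R (C, D))"
      unfolding cut_target_part_restrict[OF v CD]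
      by (rule face_restrict_in_faces[OF I Q' saturated_imp_saturated_cut_target(1)[OF v sat[OF B0(1)]] BI X])
    then have "t' B0 (face_restrict I B0 X) = t B0 (face_restrict I B0 (face_cut I Q (C, D) X))
        - t B0 (face_restrict I B0 (face_cut I Q (D, C) X))"
      unfolding face_restrict_face_cut[OF I Q v X sat[OF B0(1)] BI CD]
        face_restrict_face_cut[OF I Q v' X' sat[OF B0(1)] BI CD']
      by (simp add: t'_def cut_deriv_apply)
    moreover have "(\<Prod>B\<in>P. t' B (face_restrict I B X)) = t' B0 (face_restrict I B0 X) * ?rest"
      by (subst prod.remove[OF finP B0(1)]) (auto simp: t'_def intro!: prod.cong)
    moreover have "f (face_cut I Q (C, D) X) = t B0 (face_restrict I B0 (face_cut I Q (C, D) X)) * ?rest"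
      "f (face_cut I Q (D, C) X) = t B0 (face_restrict I B0 (face_cut I Q (D, C) X)) * ?rest"
      unfolding f[OF fc(1)] f[OF fc(2)] prod.remove[OF finP B0(1)] rest by (rule refl)+
    ultimately show "cut_deriv I Q (C, D) f X = (\<Prod>B\<in>P. t' B (face_restrict I B X))"
      by (simp add: cut_deriv_apply[OF X] left_diff_distrib)
  qed
  then show ?case by (simp add: vCD)
qed

lemma prod_pure_Gam:
  assumes I: "finite I" and P: "partition_on I P"
    and t: "\<And>B. B \<in> P \<Longrightarrow> t B \<in> Gam I (single_block I B)"
  shows "prod_pure I P t \<in> Gam I P"
proof -
  have f: "prod_pure I P t \<in> functionals I P"
    by (simp add: functionals_def prod_pure_def)
  have "semisimple I (forest_target P F) (forest_deriv I P F (prod_pure I P t))"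
    if "layered_forest P F" for F
  proof (rule forest_deriv_prod_semisimple[OF I P P saturated_block[OF P] f _ _ that])
    show "t B \<in> Gam I (part_restrict I P B)" if "B \<in> P" for B
      using t[OF that] by (simp add: part_restrict_block[OF P that])
  qed (auto simp: prod_pure_def)
  with f show ?thesis by (simp add: Gam_def)
qed

text \<open>Here \<open>g\<close> is the functional on faces of \<open>B\<close> obtained from \<open>f\<close> by freezing the
  restriction \<open>Y\<close> to the complement of \<open>B\<close>; freezing commutes with cuts inside \<open>B\<close>.\<close>

lemma forest_deriv_slice_semisimple:
  fixes f g :: "('a \<Rightarrow> real) set \<Rightarrow> 'k::field"
  assumes I: "finite I" and B: "B \<subseteq> I"
    and "partition_on I Q" "saturated Q B" "Y \<in> faces I (part_restrict I Q (I - B))"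
    and "f \<in> Gam I Q" "g \<in> functionals I (part_restrict I Q B)"
    and "\<And>X. X \<in> faces I Q \<Longrightarrow> face_restrict I (I - B) X = Y \<Longrightarrow> g (face_restrict I B X) = f X"
    and "layered_forest (part_restrict I Q B) F"
  shows "semisimple I (forest_target (part_restrict I Q B) F) (forest_deriv I (part_restrict I Q B) F g)"
  using assms(3-)
proof (induction F arbitrary: Q f g)
  case Nil
  note Q = Nil.prems(1) and sat = Nil.prems(2) and Y = Nil.prems(3) and f = Nil.prems(4)
    and g = Nil.prems(5) and fg = Nil.prems(6)
  let ?R = "part_restrict I Q B"
  note R = partition_on_part_restrict[OF Q sat B]
  have sat': "saturated Q (I - B)" using sat partition_on_block(1)[OF Q] by blast
  have "semisimple I ?R g"
  proof (rule semisimpleI[OF I R g])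
    fix Z Z' assume Z: "Z \<in> faces I ?R" "Z' \<in> faces I ?R"
      and eq: "\<And>K. K \<in> ?R \<Longrightarrow> face_restrict I K Z = face_restrict I K Z'"
    \<comment> \<open>Gluing the same \<open>Y\<close> to \<open>Z\<close> and to \<open>Z'\<close>
      moves the comparison to \<open>f\<close>: blocks inside \<open>B\<close> agree by
      \<open>eq\<close>, and restrictions to the other blocks factor through
      \<open>Y\<close>.\<close>
    obtain X where X: "X \<in> faces I Q" "face_restrict I B X = Z" "face_restrict I (I - B) X = Y"
      using faces_glue[OF I Q sat B Z(1) Y] by blast
    obtain X' where X': "X' \<in> faces I Q" "face_restrict I B X' = Z'" "face_restrict I (I - B) X' = Y"
      using faces_glue[OF I Q sat B Z(2) Y] by blast
    have "f X = f X'"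
    proof (rule semisimple_cong[OF finite_elements[OF I Q] Gam_semisimple[OF f] X(1) X'(1)])
      fix K assume K: "K \<in> Q"
      note KI = partition_on_block(1)[OF Q K]
      show "face_restrict I K X = face_restrict I K X'"
      proof (cases "K \<subseteq> B")
        case True
        then have "face_restrict I K Z = face_restrict I K Z'"
          using K by (intro eq) (simp add: part_restrict_def)
        then show ?thesis
          using face_restrict_face_restrict[OF I Q sat B X(1) KI]
            face_restrict_face_restrict[OF I Q sat B X'(1) KI] X(2) X'(2) True
          by (simp add: Int_absorb2)
      next
        case False
        then have "K \<inter> (I - B) = K" using sat K KI by blast
        then show ?thesis
          using face_restrict_face_restrict[OF I Q sat' Diff_subset X(1) KI]
            face_restrict_face_restrict[OF I Q sat' Diff_subset X'(1) KI] X(3) X'(3)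
          by simp
      qed
    qed
    then show "g Z = g Z'" using fg X X' by metis
  qed
  then show ?case by simp
next
  case (Cons v F)
  note Q = Cons.prems(1) and sat = Cons.prems(2) and Y = Cons.prems(3) and f = Cons.prems(4)
    and g = Cons.prems(5) and fg = Cons.prems(6)
  let ?R = "part_restrict I Q B"
  obtain C D where vCD: "v = (C, D)" by fastforce
  have vR: "is_cut ?R (C, D)" and F: "layered_forest (cut_target ?R (C, D)) F"
    using Cons.prems(7) by (simp_all add: vCD)
  have v: "is_cut Q (C, D)" and CD: "C \<union> D \<subseteq> B"
    using is_cut_part_restrictD[OF vR] by blast+
  have v': "is_cut Q (D, C)" and CD': "D \<union> C \<subseteq> B" using v CD by (auto simp: is_cut_swap)
  let ?Q = "cut_target Q (C, D)"
  note Q' = partition_on_cut_target[OF Q v] and sat' = saturated_imp_saturated_cut_target(1)[OF v sat]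
  note R' = cut_target_part_restrict[OF v CD, of I]
  have disj: "(C \<union> D) \<inter> (I - B) = {}" "(D \<union> C) \<inter> (I - B) = {}" using CD by blast+
  have "semisimple I (forest_target (part_restrict I ?Q B) F)
      (forest_deriv I (part_restrict I ?Q B) F (cut_deriv I ?R (C, D) g))"
  proof (rule Cons.IH[OF Q' sat' _ Gam_cut_deriv[OF f v]])
    \<comment> \<open>A cut inside \<open>B\<close> leaves the partition of the complement alone, so
      the same frozen \<open>Y\<close> serves throughout the induction.\<close>
    show "Y \<in> faces I (part_restrict I ?Q (I - B))"
      using Y by (simp add: part_restrict_cut_target_disjoint[OF v disj(1)])
    show "cut_deriv I ?R (C, D) g \<in> functionals I (part_restrict I ?Q B)"
      unfolding R'[symmetric] by (simp add: functionals_def cut_deriv_def)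
    show "layered_forest (part_restrict I ?Q B) F" using F by (simp add: R')
    fix X assume X: "X \<in> faces I ?Q" and XY: "face_restrict I (I - B) X = Y"
    note X' = X[unfolded cut_target_swap[of Q C D]]
    have "face_restrict I B X \<in> faces I (cut_target ?R (C, D))"
      unfolding R' by (rule face_restrict_in_faces[OF I Q' sat' B X])
    then have "cut_deriv I ?R (C, D) g (face_restrict I B X)
        = g (face_cut I ?R (C, D) (face_restrict I B X)) - g (face_cut I ?R (D, C) (face_restrict I B X))"
      by (rule cut_deriv_apply)
    also have "\<dots> = g (face_restrict I B (face_cut I Q (C, D) X)) - g (face_restrict I B (face_cut I Q (D, C) X))"
      by (simp only: face_restrict_face_cut[OF I Q v X sat B CD] face_restrict_face_cut[OF I Q v' X' sat B CD'])
    also have "g (face_restrict I B (face_cut I Q (C, D) X)) = f (face_cut I Q (C, D) X)"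
      using face_restrict_face_cut_disjoint[OF I Q v X Diff_subset disj(1)] XY
      by (intro fg face_cut_in_faces[OF I Q v X]) simp
    also have "g (face_restrict I B (face_cut I Q (D, C) X)) = f (face_cut I Q (D, C) X)"
      using face_restrict_face_cut_disjoint[OF I Q v' X' Diff_subset disj(2)] XY
      by (intro fg face_cut_in_faces[OF I Q v' X']) simp
    also have "f (face_cut I Q (C, D) X) - f (face_cut I Q (D, C) X) = cut_deriv I Q (C, D) f X"
      by (rule cut_deriv_apply[OF X, symmetric])
    finally show "cut_deriv I ?R (C, D) g (face_restrict I B X) = cut_deriv I Q (C, D) f X" .
  qed
  then show ?case by (simp add: vCD R')
qed

lemma Gam_in_prod_free_image:
  fixes f :: "('a \<Rightarrow> real) set \<Rightarrow> 'k::field"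
  assumes I: "finite I" and P: "partition_on I P" and f: "f \<in> Gam I P"
  shows "f \<in> prod_free I P ` free_space P (\<lambda>B. Gam I (single_block I B))"
proof -
  let ?\<Omega> = "\<lambda>B. faces I (single_block I B)"
  define glue where "glue y = (SOME X. X \<in> faces I P \<and> (\<forall>B\<in>P. face_restrict I B X = y B))" for y
  have glue: "glue y \<in> faces I P" "\<And>B. B \<in> P \<Longrightarrow> face_restrict I B (glue y) = y B"
    if y: "y \<in> PiE P ?\<Omega>" for y
  proof -
    have "\<exists>X. X \<in> faces I P \<and> (\<forall>B\<in>P. face_restrict I B X = y B)"
      using faces_glue_all[OF I P, of y] PiE_mem[OF y] by blast
    then have "glue y \<in> faces I P \<and> (\<forall>B\<in>P. face_restrict I B (glue y) = y B)"
      unfolding glue_def by (rule someI_ex)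
    then show "glue y \<in> faces I P" "\<And>B. B \<in> P \<Longrightarrow> face_restrict I B (glue y) = y B" by blast+
  qed
  have finP: "finite P" by (rule finite_elements[OF I P])
  note f_cong = semisimple_cong[OF finP Gam_semisimple[OF f]]
  have restr: "face_restrict I B X \<in> ?\<Omega> B" if "B \<in> P" "X \<in> faces I P" for B X
    using face_restrict_in_faces[OF I P saturated_block[OF P that(1)] partition_on_block(1)[OF P that(1)] that(2)]
    by (simp add: part_restrict_block[OF P that(1)])
  have part: "partition_on I (single_block I B)" if "B \<in> P" for B
    using partition_on_part_restrict[OF P saturated_block[OF P that] partition_on_block(1)[OF P that]]
    by (simp add: part_restrict_block[OF P that])
  show ?thesis
  proof (rule prod_free_surj[where \<Omega> = ?\<Omega> and \<Phi> = "\<lambda>y. f (glue y)", OF finP])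
    show "fun_vs.subspace (Gam I (single_block I B) :: (('a \<Rightarrow> real) set \<Rightarrow> 'k) set)" if "B \<in> P" for B
      by (rule Gam_subspace[OF finite_elements[OF I part[OF that]]])
    show "v X = 0" if "v \<in> Gam I (single_block I B)" "X \<notin> ?\<Omega> B" for B X and v :: "('a \<Rightarrow> real) set \<Rightarrow> 'k"
      using that by (simp add: Gam_def functionals_def)
    show "f \<in> functionals I P" using f by (simp add: Gam_def)
    show "f X = f (glue (\<lambda>B\<in>P. face_restrict I B X))" if X: "X \<in> faces I P" for X
    proof (rule f_cong[OF X])
      have y: "(\<lambda>B\<in>P. face_restrict I B X) \<in> PiE P ?\<Omega>"
        using restr X by auto
      show "glue (\<lambda>B\<in>P. face_restrict I B X) \<in> faces I P" by (rule glue(1)[OF y])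
      show "face_restrict I B X = face_restrict I B (glue (\<lambda>B\<in>P. face_restrict I B X))" if "B \<in> P" for B
        using glue(2)[OF y that] that by simp
    qed
    fix y B assume y: "y \<in> PiE P ?\<Omega>" and B: "B \<in> P"
    let ?g = "\<lambda>Z. if Z \<in> ?\<Omega> B then f (glue (y(B := Z))) else 0"
    note BI = partition_on_block(1)[OF P B] and sat = saturated_block[OF P B]
    have sat': "saturated P (I - B)" using sat partition_on_block(1)[OF P] by blast
    have Y: "face_restrict I (I - B) (glue y) \<in> faces I (part_restrict I P (I - B))"
      by (rule face_restrict_in_faces[OF I P sat' Diff_subset glue(1)[OF y]])
    have g: "?g \<in> functionals I (part_restrict I P B)"
      unfolding part_restrict_block[OF P B] by (simp add: functionals_def)
    have "?g (face_restrict I B X) = f X"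
      if X: "X \<in> faces I P" and XY: "face_restrict I (I - B) X = face_restrict I (I - B) (glue y)" for X
    proof -
      let ?y = "y(B := face_restrict I B X)"
      have y': "?y \<in> PiE P ?\<Omega>"
        using y B restr[OF B X] by (auto simp: PiE_iff extensional_def)
      \<comment> \<open>\<open>glue ?y\<close> may differ from \<open>X\<close>, but both have the
        same restrictions to all blocks, and the semisimple \<open>f\<close> cannot tell them
        apart.\<close>
      have "f (glue ?y) = f X"
      proof (rule f_cong[OF glue(1)[OF y'] X])
        fix K assume K: "K \<in> P"
        show "face_restrict I K (glue ?y) = face_restrict I K X"
        proof (cases "K = B")
          case True
          then show ?thesis using glue(2)[OF y' K] by simp
        next
          case False
          note KI = partition_on_block(1)[OF P K]
          have "K \<inter> (I - B) = K"
            using partition_on_eqI[OF P K B] False KI by blast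
          then have "face_restrict I K X = face_restrict I K (glue y)"
            using face_restrict_face_restrict[OF I P sat' Diff_subset X KI]
              face_restrict_face_restrict[OF I P sat' Diff_subset glue(1)[OF y] KI] XY by simp
          then show ?thesis using glue(2)[OF y' K] glue(2)[OF y K] False by simp
        qed
      qed
      then show ?thesis using restr[OF B X] by simp
    qed
    then have "semisimple I (forest_target (part_restrict I P B) F) (forest_deriv I (part_restrict I P B) F ?g)"
      if "layered_forest (part_restrict I P B) F" for F
      by (rule forest_deriv_slice_semisimple[OF I BI P sat Y f g _ that])
    then show "?g \<in> Gam I (single_block I B)"
      using g unfolding part_restrict_block[OF P B] by (simp add: Gam_def)
  qed (simp_all add: restr finite_faces[OF I])
qed

theorem theorem4p2:
  fixes I :: "'a set" and P :: "'a set set"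
  assumes "finite I" and "partition_on I P"
  defines "G \<equiv> \<lambda>B. (Gam I (single_block I B) :: (('a \<Rightarrow> real) set \<Rightarrow> 'k::field_char_0) set)"
  shows "bij_betw (ext_prod I P) (tensor P G) (Gam I P)
    \<and> (\<forall>A\<in>tensor P G. \<forall>B\<in>tensor P G. ext_prod I P (A + B) = ext_prod I P A + ext_prod I P B)
    \<and> (\<forall>c. \<forall>A\<in>tensor P G. ext_prod I P (tensor_scale P G c A) = fscale c (ext_prod I P A))"
proof (intro conjI ballI allI)
  note I = assms(1) and P = assms(2)
  note finP = finite_elements[OF I P]
  note ext = ext_prod_coset[OF finP, of _ G I]
  note fs = free_space_subspace[of P G, where 'c = 'k]
  have fin: "finite {t. x t \<noteq> 0}" if "x \<in> free_space P G" for x :: "_ \<Rightarrow> 'k"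
    using that by (simp add: free_space_def)
  have part: "partition_on I (single_block I B)" if "B \<in> P" for B
    using partition_on_part_restrict[OF P saturated_block[OF P that] partition_on_block(1)[OF P that]]
    by (simp add: part_restrict_block[OF P that])
  have sub: "fun_vs.subspace (G B)" if "B \<in> P" for B
    unfolding G_def by (rule Gam_subspace[OF finite_elements[OF I part[OF that]]])
  \<comment> \<open>Trivial kernel on representatives; injectivity on cosets follows by taking
    differences.\<close>
  have null: "x \<in> tensor_null P G" if "x \<in> free_space P G" "prod_free I P x = 0" for x
  proof (rule tensor_null_if_prod_free_eq_0[where \<Omega> = "\<lambda>B. faces I (single_block I B)", OF finP sub _ _ _ that])
    show "v X = 0" if "v \<in> G B" "X \<notin> faces I (single_block I B)" for B v X
      using that by (simp add: G_def Gam_def functionals_def)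
    show "\<exists>X\<in>faces I P. \<forall>B\<in>P. face_restrict I B X = y B"
      if "y \<in> (\<Pi>\<^sub>E B\<in>P. faces I (single_block I B))" for y
      using faces_glue_all[OF I P, of y] PiE_mem[OF that] by blast
  qed (simp_all add: finite_faces[OF I])
  show "bij_betw (ext_prod I P) (tensor P G) (Gam I P)"
  proof (rule bij_betw_imageI)
    show "inj_on (ext_prod I P) (tensor P G)"
    proof (rule inj_onI)
      fix A B assume "A \<in> tensor P G" "B \<in> tensor P G" and eq: "ext_prod I P A = ext_prod I P B"
      then obtain x y where x: "x \<in> free_space P G" "A = x +o tensor_null P G"
        and y: "y \<in> free_space P G" "B = y +o tensor_null P G"
        unfolding tensor_def by blast
      have "prod_free I P (x - y) = 0"
        using eq by (simp add: x y ext prod_free_diff fin)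
      then have n: "x - y \<in> tensor_null P G"
        by (intro null fun_vs.subspace_diff[OF fs] x(1) y(1))
      have shift: "u +o tensor_null P G \<subseteq> v +o tensor_null P G" if uv: "u - v \<in> tensor_null P G" for u v
      proof
        fix z assume "z \<in> u +o tensor_null P G"
        then obtain m where m: "m \<in> tensor_null P G" "z = u + m"
          unfolding elt_set_plus_def by blast
        have "z = v + ((u - v) + m)" by (simp add: m(2))
        moreover have "(u - v) + m \<in> tensor_null P G"
          by (rule fun_vs.subspace_add[OF tensor_null_subspace uv m(1)])
        ultimately show "z \<in> v +o tensor_null P G" unfolding elt_set_plus_def by blast
      qed
      have "y - x \<in> tensor_null P G"
        using fun_vs.subspace_neg[OF tensor_null_subspace n] by simp
      with n show "A = B" unfolding x(2) y(2) by (intro equalityI shift)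
    qed
    show "ext_prod I P ` tensor P G = Gam I P"
      unfolding ext_prod_image[OF finP]
    proof
      show "Gam I P \<subseteq> prod_free I P ` free_space P G"
        unfolding G_def using Gam_in_prod_free_image[OF I P] by blast
      \<comment> \<open>This inclusion is the well-definedness of the restricted product: it lands
        in \<open>Gam I P\<close>.\<close>
      show "prod_free I P ` free_space P G \<subseteq> Gam I P"
      proof (rule image_subsetI)
        fix x :: "_ \<Rightarrow> 'k" assume x: "x \<in> free_space P G"
        have "prod_pure I P t \<in> Gam I P" if "x t \<noteq> 0" for t
          using x that by (intro prod_pure_Gam[OF I P]) (auto simp: free_space_def G_def)
        then show "prod_free I P x \<in> Gam I P"
          unfolding prod_free_def
          by (intro fun_vs.subspace_sum[OF Gam_subspace[OF finP]]
              fun_vs.subspace_scale[OF Gam_subspace[OF finP]]) simp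
      qed
    qed
  qed
  show "ext_prod I P (A + B) = ext_prod I P A + ext_prod I P B"
    if AB: "A \<in> tensor P G" "B \<in> tensor P G" for A B
  proof -
    obtain x y where "x \<in> free_space P G" "A = x +o tensor_null P G"
      "y \<in> free_space P G" "B = y +o tensor_null P G"
      using AB unfolding tensor_def by blast
    then show ?thesis
      by (simp add: tensor_add_coset ext fun_vs.subspace_add[OF fs] prod_free_add fin)
  qed
  show "ext_prod I P (tensor_scale P G c A) = fscale c (ext_prod I P A)" if A: "A \<in> tensor P G" for c A
  proof -
    obtain x where "x \<in> free_space P G" "A = x +o tensor_null P G"
      using A unfolding tensor_def by blast
    then show ?thesis
      by (simp add: tensor_scale_coset ext fun_vs.subspace_scale[OF fs] prod_free_scale fin)
  qed
qed

end
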